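(* Let $X_n$ be a Harris chain on a measurable space $(\Omega,\Sigma)$ with transition operator $Q$, set $S\in\Sigma$, $\varepsilon>0$ and probability measure $\beta$ as in the context, and let $\xi_n$, $\tau$, $p_n$ and $b_\ell(n)$ be as in the context. Suppose that $$b_\ell(n)=\|P^n\delta_0-P^{n+\ell}\delta_0\|_{\mathrm{TV}}\lesssim\rho(n)\,g(\ell)$$ uniformly in $n\ge\ell\ge1$, where $\rho,g$ are regularly varying with $g$ increasing. For probability measures $\mu,\mu'$ on $\Omega$ denote $$\|\mu-\mu'\|_g=\sum_{\ell\ge0}g(\ell)\,|\mu-\mu'|(\tau=\ell)=|\mu-\mu'|(\Omega)\;\mathbb E_{X_0\sim\lambda}\,g(\tau),\qquad\text{where }\lambda=\frac{|\mu-\mu'|}{|\mu-\mu'|(\Omega)}$$ (the term $\ell=0$ vanishes because $\tau\ge1$; $\lambda$ is an arbitrary probability measure if $\mu=\mu'$). Then $$\|Q^n\mu-Q^n\mu'\|_{\mathrm{TV}}\lesssim\Bigl\{\rho(n)+\frac1{g(n)}\Bigr\}\,\|\mu-\mu'\|_g,$$ where the constant implicit in $\lesssim$ does not depend on $n\ge1$, $\mu$ or $\mu'$.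
   Context: Harris chain: $X_n$, $n\ge0$, is a Markov chain with state space $(\Omega,\Sigma)$ and transition operator $Q$ on probability measures (if $X_n\sim\mu$ then $X_{n+1}\sim Q\mu$), and there are $S\in\Sigma$, $\varepsilon>0$ and a probability measure $\beta$ on $\Omega$ such that (a) $\mathbb P(X_n\in S\text{ infinitely often}\mid X_0=x)=1$ for each $x\in\Omega$; (b) $\mathbb P(X_{n+1}\in A\mid X_n=x)\ge\varepsilon\beta(A)$ for all $A\in\Sigma$ and $x\in S$. Let $\xi_n$, $n\ge0$, be a sequence of Bernoulli random variables, independent of each other and also independent of the Markov chain $X_n$, with $\mathbb P(\xi_n=1)=\varepsilon$ and $\mathbb P(\xi_n=0)=1-\varepsilon$. Set $\tau=\inf\{k\ge1: X_{k-1}\in S\text{ and }\xi_{k-1}=1\}$ and $p_n=\mathbb P(\tau=n\mid X_0\sim\beta)$, $n\ge1$; one has $\sum_{n\ge1}p_n=1$. For probability measures $\mu,\mu'$ on $\Omega$, $|\mu-\mu'|$ is the total variation measure of $\mu-\mu'$, and $|\mu-\mu'|(\tau=n)=|\mu-\mu'|(\Omega)\,\mathbb P(\tau=n\mid X_0\sim\lambda)$ with $\lambda$ as in the claim. Model chain: with $z_n=\sum_{k>n}p_k$ and $q_n=p_{n+1}/z_n$ if $z_n>0$ ($q_n\in[0,1]$ arbitrary otherwise), $P$ is the transition operator on probability measures of the Markov chain on $\{0,1,2,\ldots\}$ that jumps from $n$ to $0$ with probability $q_n$ and from $n$ to $n+1$ with probability $1-q_n$. $b_\ell(n)=\|P^n(\delta_0-P^\ell\delta_0)\|_{\mathrm{TV}}$,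 $\delta_0$ being the unit mass at $0$. $\|\cdot\|_{\mathrm{TV}}$ is normalized so that $\|\mu-\nu\|_{\mathrm{TV}}=2\sup_{A}|\mu(A)-\nu(A)|$ for probability measures. $Y\lesssim Z$ means $Y\le CZ$ with a constant $C>0$ not depending on the variable quantities indicated. A function $\rho\colon[a,\infty)\to(0,\infty)$ is regularly varying with index $\gamma\in\mathbb R$ if $\lim_{x\to\infty}\rho(\lambda x)/\rho(x)=\lambda^\gamma$ for every $\lambda>0$; a function $\rho$ on $\{k,k+1,\ldots\}$ is regularly varying if $x\mapsto\rho(\lfloor x\rfloor)$ is; "regularly varying" means with some index.
   Formalization: The tosses ξ_n are taken independent of each other and of X_0,…,X_n only, with X_{n+1} drawn from β whenever X_n∈S and ξ_n=1 (so τ is a regeneration time), not independent of the whole chain X; under full independence the claim is false. *)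

theory Defs
  imports "HOL-Probability.Probability"
begin

section \<open>Total variation\<close>

definition tv_dist :: "'a measure \<Rightarrow> 'a measure \<Rightarrow> real" where
  "tv_dist \<mu> \<nu> = 2 * (SUP A\<in>sets \<mu>. \<bar>measure \<mu> A - measure \<nu> A\<bar>)"

text \<open>The measure \<open>|\<mu> - \<nu>|\<close>, for finite measures \<open>\<mu>\<close> and \<open>\<nu>\<close> on the same measurable space.\<close>

definition variation_measure :: "'a measure \<Rightarrow> 'a measure \<Rightarrow> 'a measure" where
  "variation_measure \<mu> \<nu> = measure_of (space \<mu>) (sets \<mu>)
     (\<lambda>A. SUP \<P>\<in>{\<P>. finite \<P> \<and> \<P> \<subseteq> sets \<mu> \<and> partition_on A \<P>}.
        \<Sum>B\<in>\<P>. ennreal \<bar>measure \<mu> B - measure \<nu> B\<bar>)"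


section \<open>Regular variation\<close>

definition regularly_varying :: "real \<Rightarrow> (real \<Rightarrow> real) \<Rightarrow> real \<Rightarrow> bool" where
  "regularly_varying a \<rho> \<gamma> \<longleftrightarrow>
     (\<forall>x\<ge>a. 0 < \<rho> x) \<and>
     (\<forall>c>0. ((\<lambda>x. \<rho> (c * x) / \<rho> x) \<longlongrightarrow> c powr \<gamma>) at_top)"

text \<open>For a function on \<open>{k, k + 1, \<dots>}\<close>; its values below \<open>k\<close> play no role.\<close>

definition regularly_varying_seq :: "nat \<Rightarrow> (nat \<Rightarrow> real) \<Rightarrow> bool" where
  "regularly_varying_seq k \<rho> \<longleftrightarrow> (\<exists>\<gamma>. regularly_varying (real k) (\<lambda>x. \<rho> (nat \<lfloor>x\<rfloor>)) \<gamma>)"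


section \<open>Markov chains\<close>

definition transition_op :: "('a \<Rightarrow> 'a measure) \<Rightarrow> 'a measure \<Rightarrow> 'a measure" where
  "transition_op K \<mu> = \<mu> \<bind> K"

text \<open>The law on path space of the Markov chain with transition kernel \<open>K\<close> and initial
  distribution \<open>\<mu>\<close>, given by the Ionescu-Tulcea theorem.\<close>

definition chain_law :: "'a measure \<Rightarrow> ('a \<Rightarrow> 'a measure) \<Rightarrow> 'a measure \<Rightarrow> (nat \<Rightarrow> 'a) measure" where
  "chain_law M K \<mu> =
     projective_family.lim UNIV
       (Ionescu_Tulcea.CI (\<lambda>n \<omega>. if n = 0 then \<mu> else K (\<omega> (n - 1))) (\<lambda>_. M))
       (\<lambda>_. M)"

locale harris_chain =
  fixes M :: "'a measure" and K :: "'a \<Rightarrow> 'a measure"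
    and S :: "'a set" and \<epsilon> :: real and \<beta> :: "'a measure"
  assumes kernel: "K \<in> M \<rightarrow>\<^sub>M prob_algebra M"
    and S_sets: "S \<in> sets M"
    and eps_pos: "0 < \<epsilon>"
    and beta_prob: "\<beta> \<in> space (prob_algebra M)"
    and recurrent: "\<And>x. x \<in> space M \<Longrightarrow>
      \<P>(\<omega> in chain_law M K (return M x). \<exists>\<^sub>\<infinity>n. \<omega> n \<in> S) = 1"
    and minorized: "\<And>x A. x \<in> S \<Longrightarrow> A \<in> sets M \<Longrightarrow>
      ennreal \<epsilon> * emeasure \<beta> A \<le> emeasure (K x) A"


section \<open>The chain with its coin tosses, and the regeneration time\<close>

text \<open>In a Harris chain, for \<open>x \<in> S\<close> one has \<open>K x = \<epsilon> \<beta> + (1 - \<epsilon>) residual_kernel K \<epsilon> \<beta> x\<close>. If \<open>\<epsilon> = 1\<close>, the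
  second summand vanishes, and any probability measure may serve as the residual one.\<close>

definition residual_kernel ::
  "('a \<Rightarrow> 'a measure) \<Rightarrow> real \<Rightarrow> 'a measure \<Rightarrow> 'a \<Rightarrow> 'a measure" where
  "residual_kernel K \<epsilon> \<beta> x =
     (if \<epsilon> < 1
      then measure_of (space (K x)) (sets (K x))
             (\<lambda>A. (emeasure (K x) A - ennreal \<epsilon> * emeasure \<beta> A) / ennreal (1 - \<epsilon>))
      else K x)"

text \<open>Joint evolution of the pair \<open>(X\<^sub>n, \<xi>\<^sub>n)\<close>. The tosses \<open>\<xi>\<^sub>n\<close> are i.i.d. Bernoulli variables with
  \<open>\<P>(\<xi>\<^sub>n = 1) = \<epsilon>\<close>, each \<open>\<xi>\<^sub>n\<close> is independent of \<open>X\<^sub>0, \<dots>, X\<^sub>n\<close> and of the other tosses, and \<open>X\<close>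
  is a Markov chain with kernel \<open>K\<close>. A successful toss at a point of \<open>S\<close> regenerates
  the chain: \<open>X\<^sub>n\<^sub>+\<^sub>1\<close> is then drawn from \<open>\<beta>\<close>. Independence
  of the tosses from the chain is thus understood as independence of \<open>\<xi>\<^sub>n\<close> from the chain up to
  time \<open>n\<close>; with tosses independent of the whole path of \<open>X\<close>, the time \<open>\<tau>\<close> below would not be a
  regeneration time.\<close>

definition split_kernel ::
  "('a \<Rightarrow> 'a measure) \<Rightarrow> 'a set \<Rightarrow> real \<Rightarrow> 'a measure \<Rightarrow> 'a \<times> bool \<Rightarrow> ('a \<times> bool) measure" where
  "split_kernel K S \<epsilon> \<beta> = (\<lambda>(x, \<xi>).
     (if x \<in> S then (if \<xi> then \<beta> else residual_kernel K \<epsilon> \<beta> x) else K x)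
       \<Otimes>\<^sub>M measure_pmf (bernoulli_pmf \<epsilon>))"

definition split_law ::
  "'a measure \<Rightarrow> ('a \<Rightarrow> 'a measure) \<Rightarrow> 'a set \<Rightarrow> real \<Rightarrow> 'a measure \<Rightarrow> 'a measure
     \<Rightarrow> (nat \<Rightarrow> 'a \<times> bool) measure" where
  "split_law M K S \<epsilon> \<beta> \<mu> =
     chain_law (M \<Otimes>\<^sub>M count_space UNIV) (split_kernel K S \<epsilon> \<beta>)
       (\<mu> \<Otimes>\<^sub>M measure_pmf (bernoulli_pmf \<epsilon>))"

definition tau :: "'a set \<Rightarrow> (nat \<Rightarrow> 'a \<times> bool) \<Rightarrow> enat" where
  "tau S \<omega> = Inf {enat k | k. 1 \<le> k \<and> fst (\<omega> (k - 1)) \<in> S \<and> snd (\<omega> (k - 1))}"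

definition tau_prob ::
  "'a measure \<Rightarrow> ('a \<Rightarrow> 'a measure) \<Rightarrow> 'a set \<Rightarrow> real \<Rightarrow> 'a measure \<Rightarrow> 'a measure \<Rightarrow> nat \<Rightarrow> real" where
  "tau_prob M K S \<epsilon> \<beta> \<mu> n = \<P>(\<omega> in split_law M K S \<epsilon> \<beta> \<mu>. tau S \<omega> = enat n)"

text \<open>\<open>|\<mu> - \<mu>'|\<close> scaled to a probability measure; the choice of \<open>\<mu>\<close> when \<open>\<mu> = \<mu>'\<close> is arbitrary.\<close>

definition normalized_variation :: "'a measure \<Rightarrow> 'a measure \<Rightarrow> 'a measure" where
  "normalized_variation \<mu> \<mu>' =
     (let V = variation_measure \<mu> \<mu>'; m = emeasure V (space V)
      in if m = 0 then \<mu> else scale_measure (1 / m) V)"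

text \<open>\<open>|\<mu> - \<mu>'|(\<tau> = n)\<close>\<close>

definition variation_tau ::
  "'a measure \<Rightarrow> ('a \<Rightarrow> 'a measure) \<Rightarrow> 'a set \<Rightarrow> real \<Rightarrow> 'a measure
     \<Rightarrow> 'a measure \<Rightarrow> 'a measure \<Rightarrow> nat \<Rightarrow> ennreal" where
  "variation_tau M K S \<epsilon> \<beta> \<mu> \<mu>' n =
     emeasure (variation_measure \<mu> \<mu>') (space M) *
     ennreal (tau_prob M K S \<epsilon> \<beta> (normalized_variation \<mu> \<mu>') n)"

text \<open>\<open>\<parallel>\<mu> - \<mu>'\<parallel>\<^sub>g\<close>, which may be infinite. The term with \<open>l = 0\<close> vanishes since \<open>\<tau> \<ge> 1\<close>.\<close>

definition g_norm ::
  "'a measure \<Rightarrow> ('a \<Rightarrow> 'a measure) \<Rightarrow> 'a set \<Rightarrow> real \<Rightarrow> 'a measure \<Rightarrow> (nat \<Rightarrow> real)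
     \<Rightarrow> 'a measure \<Rightarrow> 'a measure \<Rightarrow> ennreal" where
  "g_norm M K S \<epsilon> \<beta> g \<mu> \<mu>' = (\<Sum>l. ennreal (g l) * variation_tau M K S \<epsilon> \<beta> \<mu> \<mu>' l)"


section \<open>The model chain\<close>

definition tail_sum :: "(nat \<Rightarrow> real) \<Rightarrow> nat \<Rightarrow> real" where
  "tail_sum p n = (\<Sum>\<^sub>\<infinity>k\<in>{n<..}. p k)"

definition jump_probabilities :: "(nat \<Rightarrow> real) \<Rightarrow> (nat \<Rightarrow> real) \<Rightarrow> bool" where
  "jump_probabilities p q \<longleftrightarrow>
     (\<forall>n. q n \<in> {0..1} \<and> (tail_sum p n > 0 \<longrightarrow> q n = p (n + 1) / tail_sum p n))"

definition model_op :: "(nat \<Rightarrow> real) \<Rightarrow> nat pmf \<Rightarrow> nat pmf" where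
  "model_op q \<mu> =
     bind_pmf \<mu> (\<lambda>n. map_pmf (\<lambda>jump. if jump then 0 else n + 1) (bernoulli_pmf (q n)))"

definition model_decay :: "(nat \<Rightarrow> real) \<Rightarrow> nat \<Rightarrow> nat \<Rightarrow> real" where
  "model_decay q l n =
     tv_dist (measure_pmf ((model_op q ^^ n) (return_pmf 0)))
             (measure_pmf ((model_op q ^^ n) ((model_op q ^^ l) (return_pmf 0))))"

end

theory Submission
  imports Defs
begin

text \<open>A successful coin toss restarts the chain from \<open>\<beta>\<close>. Started from \<open>\<beta>\<close>, the time elapsed since the last
  regeneration is a copy of the model chain, and conditionally on it the law of \<open>X\<^sub>n\<close> does not depend
  on \<open>n\<close>; hence \<open>\<parallel>Q\<^sup>n \<beta> - Q\<^sup>n\<^sup>+\<^sup>l \<beta>\<parallel> \<le> b\<^sub>l(n)\<close>. For arbitrary \<open>\<mu>\<close> and \<open>\<mu>'\<close>, put \<open>m = \<lfloor>n/2\<rfloor>\<close> and decompose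
  \<open>Q\<^sup>n \<mu> - Q\<^sup>n \<mu>'\<close> according to \<open>\<tau> = k \<le> m\<close> or \<open>\<tau> > m\<close>. The part with \<open>\<tau> > m\<close> has mass at most
  \<open>|\<mu> - \<mu>'|(\<tau> > m)\<close>, which is at most \<open>\<parallel>\<mu> - \<mu>'\<parallel>\<^sub>g / g(m)\<close> by Markov's inequality. In the part with \<open>\<tau> = k\<close>,
  replacing \<open>Q\<^sup>n\<^sup>-\<^sup>k \<beta>\<close> by \<open>Q\<^sup>n \<beta>\<close> costs at most \<open>b\<^sub>k(m)\<close> per unit of mass, because \<open>n - k \<ge> m \<ge> k\<close>; and the
  total mass of \<open>\<mu> - \<mu>'\<close> on \<open>\<tau> \<le> m\<close> is minus the one on \<open>\<tau> > m\<close>. Regular variation compares \<open>\<rho>(m)\<close>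
  with \<open>\<rho>(n)\<close> and \<open>g(m)\<close> with \<open>g(n)\<close>.\<close>

section \<open>Path laws of Markov chains\<close>

text \<open>One step of the chain killed outside \<open>A\<close>:
  \<open>(kill K A ^^ n) f x\<close> is the mean, for the chain started at \<open>x\<close>, of
  \<open>f\<close> at time \<open>n\<close> on the event that the positions at times
  \<open>0, ..., n - 1\<close> all lie in \<open>A\<close>.\<close>

definition kill :: "('a \<Rightarrow> 'a measure) \<Rightarrow> 'a set \<Rightarrow> ('a \<Rightarrow> ennreal) \<Rightarrow> 'a \<Rightarrow> ennreal" where
  "kill K A f x = indicator A x * (\<integral>\<^sup>+y. f y \<partial>K x)"

lemma measurable_kill [measurable]:
  assumes [measurable]: "K \<in> M \<rightarrow>\<^sub>M prob_algebra M" "A \<in> sets M" "f \<in> borel_measurable M"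
  shows "kill K A f \<in> borel_measurable M"
proof -
  have [measurable]: "K \<in> M \<rightarrow>\<^sub>M subprob_algebra M"
    using assms(1) by (rule measurable_prob_algebraD)
  show ?thesis
    unfolding kill_def[abs_def]
    by measurable
qed

lemma measurable_kill_funpow [measurable]:
  assumes "K \<in> M \<rightarrow>\<^sub>M prob_algebra M" "A \<in> sets M" "f \<in> borel_measurable M"
  shows "(kill K A ^^ n) f \<in> borel_measurable M"
  by (induction n) (use assms in auto)

lemma kill_cong:
  "(\<And>y. y \<in> space (K x) \<Longrightarrow> f y = g y) \<Longrightarrow> kill K A f x = kill K A g x"
  unfolding kill_def by (simp cong: nn_integral_cong)

lemma Ionescu_Tulcea_chain:
  assumes K: "K \<in> M \<rightarrow>\<^sub>M prob_algebra M" and \<mu>: "\<mu> \<in> space (prob_algebra M)"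
  shows "Ionescu_Tulcea (\<lambda>n \<omega>. if n = 0 then \<mu> else K (\<omega> (n - 1))) (\<lambda>_. M)"
proof (rule Ionescu_Tulcea.intro, goal_cases)
  have K': "K \<in> M \<rightarrow>\<^sub>M subprob_algebra M"
    using K by (rule measurable_prob_algebraD)
  have \<mu>': "\<mu> \<in> space (subprob_algebra M)"
    using \<mu> by (auto simp: space_prob_algebra space_subprob_algebra prob_space_imp_subprob_space)
  case (1 i)
  show ?case
  proof (cases "i = 0")
    case False
    then have "(\<lambda>\<omega>. \<omega> (i - 1)) \<in> PiM {0..<i} (\<lambda>_. M) \<rightarrow>\<^sub>M M"
      by (intro measurable_component_singleton) simp
    from measurable_compose[OF this K'] False show ?thesis
      by simp
  qed (use \<mu>' in simp)
next
  case (2 i x)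
  show ?case
  proof (cases "i = 0")
    case False
    with 2 have "x (i - 1) \<in> space M"
      by (auto simp: space_PiM PiE_iff)
    with False measurable_space[OF K] show ?thesis
      by (simp add: space_prob_algebra)
  qed (use \<mu> in \<open>simp add: space_prob_algebra\<close>)
qed

lemma
  assumes K: "K \<in> M \<rightarrow>\<^sub>M prob_algebra M" and \<mu>: "\<mu> \<in> space (prob_algebra M)"
  shows sets_chain_law: "sets (chain_law M K \<mu>) = sets (PiM UNIV (\<lambda>_. M))"
    and prob_space_chain_law: "prob_space (chain_law M K \<mu>)"
    and emeasure_chain_law_cylinder: "X \<in> sets (PiM {0..<n} (\<lambda>_. M)) \<Longrightarrow>
      emeasure (chain_law M K \<mu>) (prod_emb UNIV (\<lambda>_. M) {0..<n} X) =
      emeasure (Ionescu_Tulcea.C (\<lambda>n \<omega>. if n = 0 then \<mu> else K (\<omega> (n - 1))) (\<lambda>_. M) 0 n (\<lambda>_. undefined)) X"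
proof -
  let ?P = "\<lambda>n \<omega>. if n = 0 then \<mu> else K (\<omega> (n - 1))"
  interpret IT: Ionescu_Tulcea ?P "\<lambda>_. M"
    using K \<mu> by (rule Ionescu_Tulcea_chain)
  have lim: "chain_law M K \<mu> = IT.PF.lim"
    by (simp add: chain_law_def)
  show "sets (chain_law M K \<mu>) = sets (PiM UNIV (\<lambda>_. M))"
    by (simp add: lim)
  let ?u = "\<lambda>_::nat. undefined :: 'a"
  have u: "?u \<in> space (PiM {0..<0} (\<lambda>_. M))"
    by (simp add: space_PiM)
  have emb: "emeasure IT.PF.lim (IT.PF.emb UNIV {0..<n} X) = emeasure (IT.C 0 n ?u) X"
    if "X \<in> sets (PiM {0..<n} (\<lambda>_. M))" for n X
    using that sets.sets_into_space[OF that]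
    by (subst IT.lim) (auto simp: IT.emeasure_CI[where n=n] space_PiM prod_emb_id)
  \<comment> \<open>The cylinder over the empty set of times is the whole path space, and its
    probability is that of a point mass; this gives total mass 1.\<close>
  have "IT.PF.emb UNIV {0..<0} {?u} = space IT.PF.lim"
    by (auto simp: prod_emb_def space_PiM)
  moreover have "{?u} \<in> sets (PiM {0..<0} (\<lambda>_. M))"
    by (simp add: sets_PiM_empty)
  ultimately have "emeasure IT.PF.lim (space IT.PF.lim) = 1"
    using emb[of "{?u}" 0] by simp
  then show "prob_space (chain_law M K \<mu>)"
    by (auto simp: lim intro!: prob_spaceI)
  show "emeasure (chain_law M K \<mu>) (prod_emb UNIV (\<lambda>_. M) {0..<n} X) = emeasure (IT.C 0 n ?u) X"
    if "X \<in> sets (PiM {0..<n} (\<lambda>_. M))"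
    using emb[OF that] by (simp add: lim)
qed

text \<open>The coordinates are integrated out one at a time, the last one first, and each
  integration contributes one factor \<open>kill K A\<close>.\<close>

lemma emeasure_chain_law:
  assumes K: "K \<in> M \<rightarrow>\<^sub>M prob_algebra M" and \<mu>: "\<mu> \<in> space (prob_algebra M)"
    and A[measurable]: "A \<in> sets M" and B[measurable]: "B \<in> sets M"
  shows "emeasure (chain_law M K \<mu>)
      {\<omega> \<in> space (chain_law M K \<mu>). (\<forall>k<n. \<omega> k \<in> A) \<and> \<omega> n \<in> B} =
    (\<integral>\<^sup>+x. (kill K A ^^ n) (indicator B) x \<partial>\<mu>)"
proof -
  note [measurable] = K
  let ?P = "\<lambda>n \<omega>. if n = 0 then \<mu> else K (\<omega> (n - 1))"
  interpret IT: Ionescu_Tulcea ?P "\<lambda>_. M"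
    using K \<mu> by (rule Ionescu_Tulcea_chain)
  let ?u = "\<lambda>_::nat. undefined :: 'a"
  have u: "?u \<in> space (PiM {0..<0} (\<lambda>_. M))"
    by (simp add: space_PiM)
  \<comment> \<open>\<open>IT.C 0 (Suc n)\<close> is the joint law of the positions at times
    \<open>0, ..., n\<close>. The test function \<open>f\<close> stays arbitrary, so that
    integrating out the last position only replaces \<open>f\<close> by
    \<open>kill K A f\<close>.\<close>
  have path: "(\<integral>\<^sup>+\<omega>. (\<Prod>k<n. indicator A (\<omega> k)) * f (\<omega> n) \<partial>IT.C 0 (Suc n) ?u) =
      (\<integral>\<^sup>+x. (kill K A ^^ n) f x \<partial>\<mu>)" if "f \<in> borel_measurable M" for f :: "'a \<Rightarrow> ennreal" and n
    using that
  proof (induction n arbitrary: f)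
    case 0
    note [measurable] = this
    have "IT.C 0 (Suc 0) ?u = IT.eP 0 ?u"
      using bind_return[OF IT.measurable_eP[of 0] u] by simp
    then show ?case
      by (subst \<open>IT.C 0 (Suc 0) ?u = _\<close>) (subst IT.nn_integral_eP, auto simp: u)
  next
    case (Suc n)
    note [measurable] = Suc.prems
    have [measurable]: "(\<lambda>\<omega>. \<omega> k) \<in> PiM {0..<m} (\<lambda>_. M) \<rightarrow>\<^sub>M M" if "k < m" for k m :: nat
      using that by (intro measurable_component_singleton) simp
    have eq: "IT.C 0 (Suc (Suc n)) ?u = IT.C 0 (Suc n) ?u \<bind> IT.eP (Suc n)"
      by simp
    have "(\<integral>\<^sup>+\<omega>. (\<Prod>k<Suc n. indicator A (\<omega> k)) * f (\<omega> (Suc n)) \<partial>IT.C 0 (Suc (Suc n)) ?u) =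
      (\<integral>\<^sup>+\<omega>. (\<integral>\<^sup>+\<omega>'. (\<Prod>k<Suc n. indicator A (\<omega>' k)) * f (\<omega>' (Suc n)) \<partial>IT.eP (Suc n) \<omega>) \<partial>IT.C 0 (Suc n) ?u)"
      unfolding eq
      by (rule nn_integral_bind[where B="PiM {0..<Suc (Suc n)} (\<lambda>_. M)"])
         (measurable, use IT.measurable_eP[of "Suc n"] in \<open>auto simp: measurable_cong_sets[OF IT.sets_C[OF u]]\<close>)
    also have "\<dots> = (\<integral>\<^sup>+\<omega>. (\<Prod>k<n. indicator A (\<omega> k)) * kill K A f (\<omega> n) \<partial>IT.C 0 (Suc n) ?u)"
    proof (rule nn_integral_cong)
      fix \<omega> assume "\<omega> \<in> space (IT.C 0 (Suc n) ?u)"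
      then have \<omega>: "\<omega> \<in> space (PiM {0..<Suc n} (\<lambda>_. M))"
        using IT.space_C[OF u, of "Suc n"] by simp
      then have "\<omega> n \<in> space M"
        by (auto simp: space_PiM PiE_iff)
      then have sK: "sets (K (\<omega> n)) = sets M"
        using measurable_space[OF K] by (simp add: space_prob_algebra)
      have "(\<integral>\<^sup>+\<omega>'. (\<Prod>k<Suc n. indicator A (\<omega>' k)) * f (\<omega>' (Suc n)) \<partial>IT.eP (Suc n) \<omega>) =
        (\<integral>\<^sup>+x. (\<Prod>k<Suc n. indicator A (\<omega> k)) * f x \<partial>K (\<omega> n))"
        by (subst IT.nn_integral_eP[OF \<omega>]) auto
      also have "\<dots> = (\<Prod>k<Suc n. indicator A (\<omega> k)) * (\<integral>\<^sup>+x. f x \<partial>K (\<omega> n))"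
        by (rule nn_integral_cmult) (simp add: measurable_cong_sets[OF sK])
      finally show "(\<integral>\<^sup>+\<omega>'. (\<Prod>k<Suc n. indicator A (\<omega>' k)) * f (\<omega>' (Suc n)) \<partial>IT.eP (Suc n) \<omega>) =
          (\<Prod>k<n. indicator A (\<omega> k)) * kill K A f (\<omega> n)"
        by (simp add: kill_def mult.assoc)
    qed
    also have "\<dots> = (\<integral>\<^sup>+x. (kill K A ^^ Suc n) f x \<partial>\<mu>)"
      by (subst Suc.IH) (simp_all add: funpow_swap1)
    finally show ?case .
  qed
  let ?X = "{\<omega> \<in> space (PiM {0..<Suc n} (\<lambda>_. M)). (\<forall>k<n. \<omega> k \<in> A) \<and> \<omega> n \<in> B}"
  have X: "?X \<in> sets (PiM {0..<Suc n} (\<lambda>_. M))"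
  proof -
    have [measurable]: "(\<lambda>\<omega>. \<omega> k) \<in> PiM {0..<Suc n} (\<lambda>_. M) \<rightarrow>\<^sub>M M" if "k \<le> n" for k
      using that by (intro measurable_component_singleton) simp
    have "?X = {\<omega> \<in> space (PiM {0..<Suc n} (\<lambda>_. M)). (\<forall>k\<in>{..<n}. \<omega> k \<in> A) \<and> \<omega> n \<in> B}"
      by auto
    also have "\<dots> \<in> sets (PiM {0..<Suc n} (\<lambda>_. M))"
      by measurable
    finally show ?thesis .
  qed
  have "{\<omega> \<in> space (chain_law M K \<mu>). (\<forall>k<n. \<omega> k \<in> A) \<and> \<omega> n \<in> B} = IT.PF.emb UNIV {0..<Suc n} ?X"
    using sets_eq_imp_space_eq[OF sets_chain_law[OF K \<mu>]]
    by (auto simp: prod_emb_def space_PiM PiE_iff)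
  then have "emeasure (chain_law M K \<mu>)
      {\<omega> \<in> space (chain_law M K \<mu>). (\<forall>k<n. \<omega> k \<in> A) \<and> \<omega> n \<in> B} = emeasure (IT.C 0 (Suc n) ?u) ?X"
    using emeasure_chain_law_cylinder[OF K \<mu> X] by simp
  also have "\<dots> = (\<integral>\<^sup>+\<omega>. indicator ?X \<omega> \<partial>IT.C 0 (Suc n) ?u)"
    using X IT.sets_C[OF u, of "Suc n"] by (subst nn_integral_indicator) (auto simp del: IT.C.simps)
  also have "\<dots> = (\<integral>\<^sup>+\<omega>. (\<Prod>k<n. indicator A (\<omega> k)) * indicator B (\<omega> n) \<partial>IT.C 0 (Suc n) ?u)"
  proof (rule nn_integral_cong)
    fix \<omega> assume "\<omega> \<in> space (IT.C 0 (Suc n) ?u)"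
    then have \<omega>: "\<omega> \<in> space (PiM {0..<Suc n} (\<lambda>_. M))"
      using IT.space_C[OF u, of "Suc n"] by simp
    show "indicator ?X \<omega> = (\<Prod>k<n. indicator A (\<omega> k)) * (indicator B (\<omega> n) :: ennreal)"
    proof (cases "\<forall>k<n. \<omega> k \<in> A")
      case False
      then obtain k where "k < n" "\<omega> k \<notin> A" by auto
      then have "(\<Prod>k<n. indicator A (\<omega> k) :: ennreal) = 0"
        by (intro prod_zero) (auto intro!: bexI[of _ k])
      with False show ?thesis by simp
    qed (use \<omega> in \<open>auto split: split_indicator\<close>)
  qed
  also have "\<dots> = (\<integral>\<^sup>+x. (kill K A ^^ n) (indicator B) x \<partial>\<mu>)"
    by (rule path) simp
  finally show "emeasure (chain_law M K \<mu>)
      {\<omega> \<in> space (chain_law M K \<mu>). (\<forall>k<n. \<omega> k \<in> A) \<and> \<omega> n \<in> B} =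
    (\<integral>\<^sup>+x. (kill K A ^^ n) (indicator B) x \<partial>\<mu>)" .
qed

section \<open>Integration against sums of measures\<close>

text \<open>The identity for sets passes to functions by induction over nonnegative measurable
  functions. The case of interest is \<open>K x\<close> on \<open>S\<close> as a mixture of the
  residual law and \<open>\<beta>\<close>.\<close>

lemma nn_integral_combine:
  assumes sets: "sets N1 = sets N" "sets N2 = sets N"
    and eq: "\<And>A. A \<in> sets N \<Longrightarrow> emeasure N A = a * emeasure N1 A + b * emeasure N2 A"
    and f: "f \<in> borel_measurable N"
  shows "(\<integral>\<^sup>+x. f x \<partial>N) = a * (\<integral>\<^sup>+x. f x \<partial>N1) + b * (\<integral>\<^sup>+x. f x \<partial>N2)"
proof -
  note cong = measurable_cong_sets[OF sets(1) refl] measurable_cong_sets[OF sets(2) refl]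
  note space = sets_eq_imp_space_eq[OF sets(1)] sets_eq_imp_space_eq[OF sets(2)]
  from f show ?thesis
  proof induction
    case (cong f g)
    from cong.hyps have "(\<integral>\<^sup>+x. f x \<partial>N) = (\<integral>\<^sup>+x. g x \<partial>N)" "(\<integral>\<^sup>+x. f x \<partial>N1) = (\<integral>\<^sup>+x. g x \<partial>N1)"
      "(\<integral>\<^sup>+x. f x \<partial>N2) = (\<integral>\<^sup>+x. g x \<partial>N2)"
      by (auto intro!: nn_integral_cong simp: space)
    then show ?case using cong.IH by simp
  next
    case (set A)
    with eq[OF set] show ?case by (simp add: sets)
  next
    case (mult u c)
    then show ?case
      by (simp add: nn_integral_cmult cong distrib_left mult_ac)
  next
    case (add u v)
    then show ?case
      by (simp add: nn_integral_add cong distrib_left add_ac)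
  next
    case (seq U)
    have "incseq (\<lambda>i. a * integral\<^sup>N N1 (U i))" "incseq (\<lambda>i. b * integral\<^sup>N N2 (U i))"
      using \<open>incseq U\<close> by (auto simp: incseq_def le_fun_def intro!: mult_left_mono nn_integral_mono)
    then have "(SUP i. a * integral\<^sup>N N1 (U i) + b * integral\<^sup>N N2 (U i)) =
        (SUP i. a * integral\<^sup>N N1 (U i)) + (SUP i. b * integral\<^sup>N N2 (U i))"
      by (rule ennreal_SUP_add)
    with seq show ?case
      by (simp add: nn_integral_monotone_convergence_SUP cong SUP_mult_left_ennreal image_comp)
  qed
qed

text \<open>The same induction with an inequality. It serves for measures of the form
  \<open>\<mu> \<le> |\<mu> - \<nu>| + \<nu>\<close>, without subtraction in
  \<open>ennreal\<close>.\<close>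

lemma nn_integral_le_add:
  assumes sets: "sets N1 = sets N" "sets N2 = sets N"
    and le: "\<And>A. A \<in> sets N \<Longrightarrow> emeasure N A \<le> emeasure N1 A + emeasure N2 A"
    and f: "f \<in> borel_measurable N"
  shows "(\<integral>\<^sup>+x. f x \<partial>N) \<le> (\<integral>\<^sup>+x. f x \<partial>N1) + (\<integral>\<^sup>+x. f x \<partial>N2)"
proof -
  note cong = measurable_cong_sets[OF sets(1) refl] measurable_cong_sets[OF sets(2) refl]
  note space = sets_eq_imp_space_eq[OF sets(1)] sets_eq_imp_space_eq[OF sets(2)]
  from f show ?thesis
  proof induction
    case (cong f g)
    from cong.hyps have "(\<integral>\<^sup>+x. f x \<partial>N) = (\<integral>\<^sup>+x. g x \<partial>N)" "(\<integral>\<^sup>+x. f x \<partial>N1) = (\<integral>\<^sup>+x. g x \<partial>N1)"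
      "(\<integral>\<^sup>+x. f x \<partial>N2) = (\<integral>\<^sup>+x. g x \<partial>N2)"
      by (auto intro!: nn_integral_cong simp: space)
    then show ?case using cong.IH by simp
  next
    case (set A)
    with le[OF set] show ?case by (simp add: sets)
  next
    case (mult u c)
    then show ?case
      by (simp add: nn_integral_cmult cong distrib_left[symmetric] mult_left_mono)
  next
    case (add u v)
    then show ?case
      using add_mono[OF add.IH] by (simp add: nn_integral_add cong add_ac)
  next
    case (seq U)
    have "(SUP i. integral\<^sup>N N (U i)) \<le> (SUP i. integral\<^sup>N N1 (U i) + integral\<^sup>N N2 (U i))"
      by (rule SUP_subset_mono) (simp_all add: seq.IH)
    also have "\<dots> = (SUP i. integral\<^sup>N N1 (U i)) + (SUP i. integral\<^sup>N N2 (U i))"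
      using \<open>incseq U\<close> by (intro ennreal_SUP_add) (auto simp: incseq_def le_fun_def intro!: nn_integral_mono)
    finally show ?case
      using seq by (simp add: nn_integral_monotone_convergence_SUP cong image_comp)
  qed
qed

section \<open>Total variation\<close>

lemma abs_measure_diff_le_tv_dist:
  assumes "prob_space \<mu>" "prob_space \<nu>" and A: "A \<in> sets \<mu>"
  shows "2 * \<bar>measure \<mu> A - measure \<nu> A\<bar> \<le> tv_dist \<mu> \<nu>"
proof -
  interpret \<mu>: prob_space \<mu> by fact
  interpret \<nu>: prob_space \<nu> by fact
  have "\<bar>measure \<mu> B - measure \<nu> B\<bar> \<le> 1" for B
    using \<mu>.prob_le_1[of B] \<nu>.prob_le_1[of B] measure_nonneg[of \<mu> B] measure_nonneg[of \<nu> B] by linarith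
  then have "bdd_above ((\<lambda>A. \<bar>measure \<mu> A - measure \<nu> A\<bar>) ` sets \<mu>)"
    by (intro bdd_aboveI2)
  from cSUP_upper[OF A this] show ?thesis
    by (simp add: tv_dist_def)
qed

text \<open>Splitting \<open>J\<close> by the sign of the difference gives two sets on each of which
  the sum is a difference of measures, hence at most half of \<open>tv_dist\<close>.\<close>

lemma sum_abs_pmf_diff_le_tv_dist:
  assumes J: "finite J"
  shows "(\<Sum>j\<in>J. \<bar>pmf \<mu> j - pmf \<nu> j\<bar>) \<le> tv_dist (measure_pmf \<mu>) (measure_pmf \<nu>)"
proof -
  have *: "2 * \<bar>\<Sum>j\<in>I. pmf \<mu> j - pmf \<nu> j\<bar> \<le> tv_dist (measure_pmf \<mu>) (measure_pmf \<nu>)"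
    if "I \<subseteq> J" for I
  proof -
    have "finite I" using that J by (rule finite_subset)
    then have "(\<Sum>j\<in>I. pmf \<mu> j - pmf \<nu> j) = measure \<mu> I - measure \<nu> I"
      by (simp add: measure_measure_pmf_finite sum_subtractf)
    then show ?thesis
      using abs_measure_diff_le_tv_dist[of "measure_pmf \<mu>" "measure_pmf \<nu>" I]
      by (simp add: prob_space_measure_pmf)
  qed
  let ?I = "{j \<in> J. pmf \<nu> j \<le> pmf \<mu> j}"
  have "(\<Sum>j\<in>J. \<bar>pmf \<mu> j - pmf \<nu> j\<bar>) =
      (\<Sum>j\<in>?I. \<bar>pmf \<mu> j - pmf \<nu> j\<bar>) + (\<Sum>j\<in>J - ?I. \<bar>pmf \<mu> j - pmf \<nu> j\<bar>)"
    using J by (subst sum.subset_diff[of ?I]) auto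
  also have "(\<Sum>j\<in>?I. \<bar>pmf \<mu> j - pmf \<nu> j\<bar>) = (\<Sum>j\<in>?I. pmf \<mu> j - pmf \<nu> j)"
    by (intro sum.cong) auto
  also have "(\<Sum>j\<in>J - ?I. \<bar>pmf \<mu> j - pmf \<nu> j\<bar>) = - (\<Sum>j\<in>J - ?I. pmf \<mu> j - pmf \<nu> j)"
    unfolding sum_negf[symmetric] by (intro sum.cong) auto
  finally show ?thesis
    using *[of ?I] *[of "J - ?I"] by (auto simp: abs_if split: if_splits)
qed

text \<open>A Hahn decomposition gives an explicit candidate for the variation. The supremum over
  finite partitions equals it, being attained by the two pieces of the decomposition. Thus the set
  function in \<open>variation_measure\<close> is countably additive and \<open>measure_of\<close>
  has the expected values.\<close>

lemma
  assumes "prob_space \<mu>" "prob_space \<nu>" and sets: "sets \<nu> = sets \<mu>"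
  shows sets_variation_measure: "sets (variation_measure \<mu> \<nu>) = sets \<mu>"
    and emeasure_variation_measure_finite: "emeasure (variation_measure \<mu> \<nu>) A < \<infinity>"
    and abs_diff_le_variation_measure: "A \<in> sets \<mu> \<Longrightarrow>
      ennreal \<bar>measure \<mu> A - measure \<nu> A\<bar> \<le> emeasure (variation_measure \<mu> \<nu>) A"
proof -
  interpret \<mu>: prob_space \<mu> by fact
  interpret \<nu>: prob_space \<nu> by fact
  show s: "sets (variation_measure \<mu> \<nu>) = sets \<mu>"
    by (simp add: variation_measure_def)
  obtain D where D: "D \<in> sets \<mu>" and pos: "\<And>X. X \<in> sets \<mu> \<Longrightarrow> X \<subseteq> D \<Longrightarrow> emeasure \<nu> X \<le> emeasure \<mu> X"
    and neg: "\<And>X. X \<in> sets \<mu> \<Longrightarrow> X \<inter> D = {} \<Longrightarrow> emeasure \<mu> X \<le> emeasure \<nu> X"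
    using finite_unsigned_Hahn_decomposition[OF \<mu>.finite_measure_axioms \<nu>.finite_measure_axioms sets] by auto
  \<comment> \<open>The positive part of \<open>\<mu> - \<nu>\<close> lives on \<open>D\<close>, the
    negative part off \<open>D\<close>.\<close>
  define v where "v A = (measure \<mu> (A \<inter> D) - measure \<nu> (A \<inter> D)) + (measure \<nu> (A - D) - measure \<mu> (A - D))" for A
  have pos': "measure \<nu> (A \<inter> D) \<le> measure \<mu> (A \<inter> D)"
    and neg': "measure \<mu> (A - D) \<le> measure \<nu> (A - D)" if "A \<in> sets \<mu>" for A
    using pos[of "A \<inter> D"] neg[of "A - D"] that D by (auto simp: \<mu>.emeasure_eq_measure \<nu>.emeasure_eq_measure)
  have v0: "0 \<le> v A" if "A \<in> sets \<mu>" for A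
    using pos'[OF that] neg'[OF that] by (simp add: v_def)
  have abs_v: "\<bar>measure \<mu> A - measure \<nu> A\<bar> \<le> v A" if "A \<in> sets \<mu>" for A
  proof -
    have split: "measure N A = measure N (A \<inter> D) + measure N (A - D)" if "prob_space N" "sets N = sets \<mu>" for N
    proof -
      interpret N: prob_space N by fact
      show ?thesis
        using \<open>A \<in> sets \<mu>\<close> D that(2)
        by (subst N.finite_measure_Union[symmetric]) (auto intro!: arg_cong[where f="measure N"])
    qed
    show ?thesis
      using split[of \<mu>] split[of \<nu>] assms pos'[OF that] neg'[OF that] by (simp add: v_def)
  qed
  define W where "W = measure_of (space \<mu>) (sets \<mu>) (\<lambda>A. ennreal (v A))"
  have W: "emeasure W A = ennreal (v A)" if "A \<in> sets \<mu>" for A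
    unfolding W_def
  proof (rule emeasure_measure_of_sigma[OF sets.sigma_algebra_axioms _ _ that])
    show "positive (sets \<mu>) (\<lambda>A. ennreal (v A))"
      by (simp add: positive_def v_def)
    show "countably_additive (sets \<mu>) (\<lambda>A. ennreal (v A))"
    proof (rule countably_additiveI)
      fix F :: "nat \<Rightarrow> 'a set"
      assume F: "range F \<subseteq> sets \<mu>" "disjoint_family F" "(\<Union>i. F i) \<in> sets \<mu>"
      have sums: "(\<lambda>i. measure N (F i \<inter> D)) sums measure N ((\<Union>i. F i) \<inter> D)"
        "(\<lambda>i. measure N (F i - D)) sums measure N ((\<Union>i. F i) - D)"
        if "prob_space N" "sets N = sets \<mu>" for N
      proof -
        interpret N: prob_space N by fact
        have eq: "(\<Union>i. F i) \<inter> D = (\<Union>i. F i \<inter> D)" "(\<Union>i. F i) - D = (\<Union>i. F i - D)"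
          by auto
        have r: "range (\<lambda>i. F i \<inter> D) \<subseteq> sets N" "range (\<lambda>i. F i - D) \<subseteq> sets N"
          using F(1) D that(2) by auto
        have d: "disjoint_family (\<lambda>i. F i \<inter> D)" "disjoint_family (\<lambda>i. F i - D)"
          using F(2) by (auto simp: disjoint_family_on_def)
        show "(\<lambda>i. measure N (F i \<inter> D)) sums measure N ((\<Union>i. F i) \<inter> D)"
          "(\<lambda>i. measure N (F i - D)) sums measure N ((\<Union>i. F i) - D)"
          unfolding eq by (rule N.finite_measure_UNION[OF r(1) d(1)], rule N.finite_measure_UNION[OF r(2) d(2)])
      qed
      have "(\<lambda>i. v (F i)) sums v (\<Union>i. F i)"
        unfolding v_def using assms by (intro sums_add sums_diff sums) auto
      then show "(\<Sum>i. ennreal (v (F i))) = ennreal (v (\<Union>i. F i))"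
        using F by (intro suminf_ennreal_eq v0) auto
    qed
  qed
  have "variation_measure \<mu> \<nu> = W"
    unfolding variation_measure_def W_def
  proof (rule measure_of_eq[OF sets.space_closed])
    fix A assume "A \<in> sigma_sets (space \<mu>) (sets \<mu>)"
    then have A: "A \<in> sets \<mu>" by (simp add: sets.sigma_sets_eq)
    let ?PS = "{\<P>. finite \<P> \<and> \<P> \<subseteq> sets \<mu> \<and> partition_on A \<P>}"
    let ?d = "\<lambda>B. ennreal \<bar>measure \<mu> B - measure \<nu> B\<bar>"
    show "(SUP \<P>\<in>?PS. \<Sum>B\<in>\<P>. ?d B) = ennreal (v A)"
    proof (rule antisym)
      show "(SUP \<P>\<in>?PS. \<Sum>B\<in>\<P>. ?d B) \<le> ennreal (v A)"
      proof (rule SUP_least)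
        fix \<P> assume "\<P> \<in> ?PS"
        then have P: "finite \<P>" "\<P> \<subseteq> sets \<mu>" "partition_on A \<P>" by auto
        have "(\<Sum>B\<in>\<P>. ?d B) \<le> (\<Sum>B\<in>\<P>. emeasure W B)"
          using P abs_v by (intro sum_mono) (auto simp: W ennreal_leI)
        also have "\<dots> = emeasure W (\<Union>B\<in>\<P>. B)"
          using P by (intro sum_emeasure) (auto simp: W_def sets.sigma_sets_eq sets.space_closed
              partition_on_def disjoint_def disjoint_family_on_def)
        also have "(\<Union>B\<in>\<P>. B) = A"
          using P by (auto simp: partition_on_def)
        finally show "(\<Sum>B\<in>\<P>. ?d B) \<le> ennreal (v A)"
          by (simp add: W A)
      qed
      \<comment> \<open>A partition has no empty blocks, so an empty piece is removed; it
        contributes 0 to the sum.\<close>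
      let ?P = "{A \<inter> D, A - D} - {{}}"
      have "ennreal (v A) = (\<Sum>B\<in>{A \<inter> D, A - D}. ?d B)"
      proof (cases "A \<inter> D = A - D")
        case True
        then have "A = {}" by auto
        then show ?thesis by (simp add: v_def)
      next
        case False
        then show ?thesis
          using pos'[OF A] neg'[OF A] by (simp add: v_def ennreal_plus[symmetric] del: ennreal_plus)
      qed
      also have "\<dots> = (\<Sum>B\<in>?P. ?d B)"
        by (intro sum.mono_neutral_right) auto
      also have "\<dots> \<le> (SUP \<P>\<in>?PS. \<Sum>B\<in>\<P>. ?d B)"
        using A D by (intro SUP_upper) (auto simp: partition_on_def disjoint_def)
      finally show "ennreal (v A) \<le> (SUP \<P>\<in>?PS. \<Sum>B\<in>\<P>. ?d B)" .
    qed
  qed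
  note VW = this
  show "emeasure (variation_measure \<mu> \<nu>) A < \<infinity>"
  proof (cases "A \<in> sets \<mu>")
    case False
    then show ?thesis using s by (simp add: emeasure_notin_sets)
  qed (simp add: VW W)
  show "ennreal \<bar>measure \<mu> A - measure \<nu> A\<bar> \<le> emeasure (variation_measure \<mu> \<nu>) A" if "A \<in> sets \<mu>"
    using abs_v[OF that] by (simp add: VW W that ennreal_leI)
qed

lemma variation_measure_finite:
  assumes "prob_space \<mu>" "prob_space \<nu>" "sets \<nu> = sets \<mu>"
  shows "finite_measure (variation_measure \<mu> \<nu>)"
  using emeasure_variation_measure_finite[OF assms] by (intro finite_measureI) (rule less_imp_neq)

text \<open>Each of \<open>\<mu>\<close> and \<open>\<nu>\<close> is bounded on sets by the other
  one plus the variation. Integrating both bounds gives the two signs of the absolute value;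
  \<open>f \<le> 1\<close> keeps all integrals finite, so that \<open>enn2real\<close> respects
  them.\<close>

lemma nn_integral_diff_le_variation:
  assumes \<mu>: "prob_space \<mu>" and \<nu>: "prob_space \<nu>" and sets: "sets \<nu> = sets \<mu>"
    and f: "f \<in> borel_measurable \<mu>" and f1: "\<And>x. x \<in> space \<mu> \<Longrightarrow> f x \<le> 1"
  shows "\<bar>enn2real (\<integral>\<^sup>+x. f x \<partial>\<mu>) - enn2real (\<integral>\<^sup>+x. f x \<partial>\<nu>)\<bar>
    \<le> enn2real (\<integral>\<^sup>+x. f x \<partial>variation_measure \<mu> \<nu>)"
proof -
  let ?V = "variation_measure \<mu> \<nu>"
  interpret \<mu>: prob_space \<mu> by fact
  interpret \<nu>: prob_space \<nu> by fact
  interpret V: finite_measure ?V using \<mu> \<nu> sets by (rule variation_measure_finite)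
  note sV = sets_variation_measure[OF \<mu> \<nu> sets]
  note abs = abs_diff_le_variation_measure[OF \<mu> \<nu> sets]
  have le: "emeasure \<mu> A \<le> emeasure ?V A + emeasure \<nu> A"
    and le': "emeasure \<nu> A \<le> emeasure ?V A + emeasure \<mu> A" if "A \<in> sets \<mu>" for A
    using abs[OF that] by (auto simp: \<mu>.emeasure_eq_measure \<nu>.emeasure_eq_measure V.emeasure_eq_measure
        ennreal_plus[symmetric] simp del: ennreal_plus)
  have fin: "(\<integral>\<^sup>+x. f x \<partial>N) < \<top>" if "finite_measure N" "sets N = sets \<mu>" for N
  proof -
    interpret N: finite_measure N by fact
    have "(\<integral>\<^sup>+x. f x \<partial>N) \<le> (\<integral>\<^sup>+x. 1 \<partial>N)"
      using f1 sets_eq_imp_space_eq[OF that(2)] by (intro nn_integral_mono) auto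
    also have "\<dots> < \<top>"
      using N.emeasure_finite[of "space N"] by (simp add: less_top[symmetric])
    finally show ?thesis .
  qed
  obtain a where a: "(\<integral>\<^sup>+x. f x \<partial>\<mu>) = ennreal a" "0 \<le> a"
    using fin[OF \<mu>.finite_measure_axioms refl] by (cases "\<integral>\<^sup>+x. f x \<partial>\<mu>") auto
  obtain b where b: "(\<integral>\<^sup>+x. f x \<partial>\<nu>) = ennreal b" "0 \<le> b"
    using fin[OF \<nu>.finite_measure_axioms sets] by (cases "\<integral>\<^sup>+x. f x \<partial>\<nu>") auto
  obtain c where c: "(\<integral>\<^sup>+x. f x \<partial>?V) = ennreal c" "0 \<le> c"
    using fin[OF V.finite_measure_axioms sV] by (cases "\<integral>\<^sup>+x. f x \<partial>?V") auto
  have f': "f \<in> borel_measurable \<nu>"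
    using f measurable_cong_sets[OF sets refl] by blast
  have "ennreal a \<le> ennreal c + ennreal b"
    unfolding a(1)[symmetric] b(1)[symmetric] c(1)[symmetric]
    by (rule nn_integral_le_add[OF sV sets le f])
  moreover have "ennreal b \<le> ennreal c + ennreal a"
    unfolding a(1)[symmetric] b(1)[symmetric] c(1)[symmetric]
    by (rule nn_integral_le_add) (use sV sets le' f' in auto)
  ultimately show ?thesis
    using a b c by (simp add: ennreal_plus[symmetric] abs_le_iff del: ennreal_plus)
qed

section \<open>The model chain\<close>

lemma pmf_model_op_Suc:
  assumes q: "\<And>n. 0 \<le> q n \<and> q n \<le> 1"
  shows "pmf (model_op q \<mu>) (Suc j) = pmf \<mu> j * (1 - q j)"
proof -
  have "pmf (map_pmf (\<lambda>jump. if jump then 0 else n + 1) (bernoulli_pmf (q n))) (Suc j) =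
      indicator {j} n * (1 - q n)" for n
  proof -
    have "(\<lambda>jump. if jump then 0 else n + 1) -` {Suc j} = (if n = j then {False} else {})"
      by (auto split: if_splits)
    then show ?thesis
      using q by (simp add: pmf_map measure_pmf_single)
  qed
  then have "pmf (model_op q \<mu>) (Suc j) = measure_pmf.expectation \<mu> (\<lambda>n. indicator {j} n * (1 - q n))"
    by (simp add: model_op_def pmf_bind)
  also have "\<dots> = pmf \<mu> j * (1 - q j)"
    by (subst integral_measure_pmf[of "{j}"]) (auto split: split_indicator_asm)
  finally show ?thesis .
qed

lemma pmf_model_op_0:
  assumes q: "\<And>n. 0 \<le> q n \<and> q n \<le> 1" and \<mu>: "\<And>n. n > m \<Longrightarrow> pmf \<mu> n = 0"
  shows "pmf (model_op q \<mu>) 0 = (\<Sum>n\<le>m. pmf \<mu> n * q n)"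
proof -
  have "pmf (map_pmf (\<lambda>jump. if jump then 0 else n + 1) (bernoulli_pmf (q n))) 0 = q n" for n
  proof -
    have "(\<lambda>jump. if jump then 0 else n + 1) -` {0 :: nat} = {True}"
      by (auto split: if_splits)
    then show ?thesis
      using q by (simp add: pmf_map measure_pmf_single)
  qed
  then have "pmf (model_op q \<mu>) 0 = measure_pmf.expectation \<mu> q"
    by (simp add: model_op_def pmf_bind)
  also have "\<dots> = (\<Sum>n\<le>m. pmf \<mu> n * q n)"
    using \<mu> by (subst integral_measure_pmf[of "{..m}"]) (auto simp: set_pmf_iff not_le[symmetric])
  finally show ?thesis .
qed

definition model_state :: "(nat \<Rightarrow> real) \<Rightarrow> nat \<Rightarrow> nat pmf" where
  "model_state q m = (model_op q ^^ m) (return_pmf 0)"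

lemma model_decay_eq:
  "model_decay q l n = tv_dist (measure_pmf (model_state q n)) (measure_pmf (model_state q (n + l)))"
  by (simp add: model_decay_def model_state_def funpow_add)

text \<open>The chain is at \<open>j\<close> at time \<open>m\<close> exactly if it was at 0 at time
  \<open>m - j\<close> and has climbed ever since. The climb has probability \<open>z j\<close>, the
  product of the factors \<open>1 - q i\<close> over \<open>i < j\<close>.\<close>

lemma pmf_model_state:
  assumes q: "\<And>n. 0 \<le> q n \<and> q n \<le> 1"
    and z0: "z 0 = 1" and z: "\<And>n. z n * (1 - q n) = z (Suc n)"
  shows "pmf (model_state q m) j = (if j \<le> m then pmf (model_state q (m - j)) 0 * z j else 0)"
proof (induction m arbitrary: j)
  case 0
  show ?case by (auto simp: model_state_def z0)
next
  case (Suc m)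
  show ?case
  proof (cases j)
    case 0
    then show ?thesis by (simp add: z0)
  next
    case (Suc i)
    have "pmf (model_state q (Suc m)) (Suc i) = pmf (model_state q m) i * (1 - q i)"
      using q by (simp add: model_state_def pmf_model_op_Suc)
    with Suc show ?thesis
      by (simp add: Suc.IH[of i] z mult.assoc)
  qed
qed

section \<open>Regularly varying sequences\<close>

lemma regularly_varying_seq_pos:
  assumes "regularly_varying_seq 1 \<rho>" "1 \<le> n"
  shows "0 < \<rho> n"
proof -
  have "\<forall>x\<ge>1. 0 < \<rho> (nat \<lfloor>x :: real\<rfloor>)"
    using assms(1) by (simp add: regularly_varying_seq_def regularly_varying_def)
  from this[rule_format, of "real n"] assms(2) show ?thesis
    by simp
qed

text \<open>The ratio of \<open>\<rho> (n div 2)\<close> to \<open>\<rho> n\<close> tends to the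
  positive number \<open>(1 / 2) powr \<gamma>\<close>. Hence it and its reciprocal are bounded
  sequences. For \<open>n \<ge> 2\<close> both arguments are at least 1, where \<open>\<rho>\<close>
  is positive.\<close>

lemma regularly_varying_seq_half:
  assumes rv: "regularly_varying_seq 1 \<rho>"
  obtains c C where "0 < c" "0 < C"
    "\<And>n. 2 \<le> n \<Longrightarrow> \<rho> (n div 2) \<le> C * \<rho> n" "\<And>n. 2 \<le> n \<Longrightarrow> c * \<rho> n \<le> \<rho> (n div 2)"
proof -
  obtain \<gamma> where "\<forall>c>0. ((\<lambda>x. \<rho> (nat \<lfloor>c * x\<rfloor>) / \<rho> (nat \<lfloor>x :: real\<rfloor>)) \<longlongrightarrow> c powr \<gamma>) at_top"
    using rv unfolding regularly_varying_seq_def regularly_varying_def by blast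
  then have "((\<lambda>x. \<rho> (nat \<lfloor>1 / 2 * x\<rfloor>) / \<rho> (nat \<lfloor>x :: real\<rfloor>)) \<longlongrightarrow> (1 / 2) powr \<gamma>) at_top"
    by (rule allE[where x="1 / 2"]) simp
  from filterlim_compose[OF this filterlim_real_sequentially]
  have lim: "(\<lambda>n. \<rho> (n div 2) / \<rho> n) \<longlonglongrightarrow> (1 / 2) powr \<gamma>"
    using floor_divide_of_nat_eq[of _ 2, where ?'a = real] by simp
  have *: "\<exists>C>0. \<forall>n. \<bar>f n\<bar> \<le> C" if "convergent f" for f :: "nat \<Rightarrow> real"
    using convergent_imp_Bseq[OF that] by (auto simp: Bseq_def)
  obtain C where C: "0 < C" "\<And>n. \<bar>\<rho> (n div 2) / \<rho> n\<bar> \<le> C"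
    using *[OF convergentI[OF lim]] by blast
  have "(\<lambda>n. inverse (\<rho> (n div 2) / \<rho> n)) \<longlonglongrightarrow> inverse ((1 / 2) powr \<gamma>)"
    using lim by (intro tendsto_inverse) auto
  from *[OF convergentI[OF this]] obtain D where D: "0 < D" "\<And>n. \<bar>\<rho> n / \<rho> (n div 2)\<bar> \<le> D"
    by auto
  show thesis
  proof (rule that[of "1 / D" C])
    fix n :: nat assume n: "2 \<le> n"
    then have pos: "0 < \<rho> n" "0 < \<rho> (n div 2)"
      by (auto intro!: regularly_varying_seq_pos[OF rv])
    then show "\<rho> (n div 2) \<le> C * \<rho> n" "1 / D * \<rho> n \<le> \<rho> (n div 2)"
      using C(2)[of n] D(2)[of n] D(1) by (simp_all add: field_simps)
  qed (use C D in auto)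
qed

section \<open>The regeneration time of a Harris chain\<close>

text \<open>The index shifts by one: \<open>\<tau>\<close> is one more than the time of the first
  successful toss in \<open>S\<close>. A finite infimum in \<open>enat\<close> is attained, while
  the infimum of the empty set is infinite.\<close>

lemma tau_eq_Suc_iff:
  "tau S \<omega> = enat (Suc n) \<longleftrightarrow>
    (\<forall>k<n. \<not> (fst (\<omega> k) \<in> S \<and> snd (\<omega> k))) \<and> fst (\<omega> n) \<in> S \<and> snd (\<omega> n)"
    (is "_ \<longleftrightarrow> (\<forall>k<n. \<not> ?good k) \<and> _")
proof -
  let ?T = "{enat k | k. 1 \<le> k \<and> ?good (k - 1)}"
  have mem: "enat (Suc k) \<in> ?T" if "?good k" for k
    using that by (intro CollectI exI[of _ "Suc k"]) auto
  show ?thesis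
  proof
    assume eq: "tau S \<omega> = enat (Suc n)"
    have ne: "?T \<noteq> {}"
    proof
      assume "?T = {}"
      then have "tau S \<omega> = Inf {}"
        unfolding tau_def by (simp only:)
      with eq show False by (simp add: Inf_enat_def)
    qed
    then obtain t where "t \<in> ?T"
      unfolding ex_in_conv[symmetric] by (rule exE)
    then have "Inf ?T \<in> ?T"
      by (rule wellorder_InfI)
    moreover have "Inf ?T = enat (Suc n)"
      using eq unfolding tau_def .
    ultimately have "enat (Suc n) \<in> ?T"
      by (rule back_subst[where P="\<lambda>x. x \<in> ?T"])
    moreover have "\<not> ?good k" if "k < n" for k
    proof
      assume "?good k"
      then have "enat (Suc n) \<le> enat (Suc k)"
        using Inf_lower[OF mem[of k]] eq unfolding tau_def by simp
      with that show False by simp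
    qed
    ultimately show "(\<forall>k<n. \<not> ?good k) \<and> fst (\<omega> n) \<in> S \<and> snd (\<omega> n)"
      by auto
  next
    assume r: "(\<forall>k<n. \<not> ?good k) \<and> fst (\<omega> n) \<in> S \<and> snd (\<omega> n)"
    show "tau S \<omega> = enat (Suc n)"
      unfolding tau_def
    proof (rule antisym)
      show "Inf ?T \<le> enat (Suc n)"
        using r by (intro Inf_lower mem) auto
      show "enat (Suc n) \<le> Inf ?T"
      proof (rule Inf_greatest)
        fix t assume "t \<in> ?T"
        then obtain k where t: "t = enat k" and k: "1 \<le> k" "?good (k - 1)" by auto
        then have "\<not> k - 1 < n" using r by auto
        with k show "enat (Suc n) \<le> t" by (simp add: t)
      qed
    qed
  qed
qed

lemma tau_nonzero: "tau S \<omega> \<noteq> enat 0"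
proof
  assume "tau S \<omega> = enat 0"
  moreover have "enat 1 \<le> tau S \<omega>"
    unfolding tau_def by (rule Inf_greatest) auto
  ultimately show False by simp
qed

context harris_chain
begin

lemma kernel_prob: "x \<in> space M \<Longrightarrow> prob_space (K x)"
  and sets_kernel: "x \<in> space M \<Longrightarrow> sets (K x) = sets M"
  using measurable_space[OF kernel] by (auto simp: space_prob_algebra)

lemma prob_space_\<beta>: "prob_space \<beta>" and sets_\<beta>: "sets \<beta> = sets M"
  using beta_prob by (auto simp: space_prob_algebra)

lemma space_\<beta>: "space \<beta> = space M"
  using sets_\<beta> by (rule sets_eq_imp_space_eq)

lemma S_subset: "x \<in> S \<Longrightarrow> x \<in> space M"
  using S_sets sets.sets_into_space by auto

lemma return_in_prob_algebra: "x \<in> space M \<Longrightarrow> return M x \<in> space (prob_algebra M)"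
  by (auto simp: space_prob_algebra prob_space_return)

text \<open>Recurrence makes \<open>S\<close> nonempty, and at a point of \<open>S\<close>
  minorization is applied to the whole space.\<close>

lemma eps_le_1: "\<epsilon> \<le> 1"
proof -
  obtain x where x: "x \<in> space M"
    using prob_space.not_empty[OF prob_space_\<beta>] by (auto simp: space_\<beta>)
  have "S \<noteq> {}"
  proof
    assume "S = {}"
    with recurrent[OF x] show False by simp
  qed
  then obtain y where y: "y \<in> S" by auto
  from minorized[OF y, of "space M"] have "ennreal \<epsilon> \<le> 1"
    using prob_space.emeasure_space_1[OF kernel_prob[OF S_subset[OF y]]]
      prob_space.emeasure_space_1[OF prob_space_\<beta>]
      sets_eq_imp_space_eq[OF sets_kernel[OF S_subset[OF y]]] space_\<beta> by simp
  then show ?thesis by simp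
qed

section \<open>The residual kernel\<close>

lemma emeasure_diff_minorized:
  assumes x: "x \<in> S" and A: "A \<in> sets M"
  shows "emeasure (diff_measure (K x) (scale_measure (ennreal \<epsilon>) \<beta>)) A =
    emeasure (K x) A - ennreal \<epsilon> * emeasure \<beta> A"
proof -
  interpret Kx: prob_space "K x" using x S_subset by (intro kernel_prob) auto
  interpret \<beta>: prob_space \<beta> by (rule prob_space_\<beta>)
  have "finite_measure (scale_measure (ennreal \<epsilon>) \<beta>)"
    by (intro finite_measureI) (simp add: space_scale_measure ennreal_mult_eq_top_iff)
  with emeasure_diff_measure[OF Kx.finite_measure_axioms this, of A] show ?thesis
    using A minorized[OF x] by (simp add: sets_kernel[OF S_subset[OF x]] sets_\<beta>)
qed

text \<open>Identifies the set function of \<open>residual_kernel\<close> with a scaled difference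
  of measures. This proves its countable additivity, so that its values can be computed.\<close>

lemma residual_kernel_eq:
  assumes x: "x \<in> S" and "\<epsilon> < 1"
  shows "residual_kernel K \<epsilon> \<beta> x =
    scale_measure (inverse (ennreal (1 - \<epsilon>))) (diff_measure (K x) (scale_measure (ennreal \<epsilon>) \<beta>))"
    (is "_ = ?D")
proof -
  note s = sets_kernel[OF S_subset[OF x]]
  have D: "emeasure ?D A = (emeasure (K x) A - ennreal \<epsilon> * emeasure \<beta> A) / ennreal (1 - \<epsilon>)"
    if "A \<in> sets M" for A
    using that x by (simp add: emeasure_diff_minorized divide_ennreal_def mult.commute)
  have "residual_kernel K \<epsilon> \<beta> x = measure_of (space (K x)) (sets (K x)) (emeasure ?D)"
    unfolding residual_kernel_def using \<open>\<epsilon> < 1\<close>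
    by (auto simp: sets.space_closed D s sets.sigma_sets_eq sets_eq_imp_space_eq[OF s] simp del: emeasure_scale_measure
        intro!: measure_of_eq dest: sets.sets_into_space)
  also have "\<dots> = ?D"
    using measure_of_of_measure[of ?D] by (simp add: space_scale_measure)
  finally show ?thesis .
qed

text \<open>The law of the next state given that no regeneration takes place at \<open>x\<close>, as
  one kernel on all of \<open>M\<close>.\<close>

definition residual :: "'a \<Rightarrow> 'a measure" where
  "residual x = (if x \<in> S then residual_kernel K \<epsilon> \<beta> x else K x)"

lemma emeasure_residual:
  assumes x: "x \<in> space M" and A: "A \<in> sets M"
  shows "emeasure (residual x) A = (if x \<in> S \<and> \<epsilon> < 1
    then (emeasure (K x) A - ennreal \<epsilon> * emeasure \<beta> A) / ennreal (1 - \<epsilon>) else emeasure (K x) A)"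
proof (cases "x \<in> S \<and> \<epsilon> < 1")
  case True
  with A show ?thesis
    by (simp add: residual_def residual_kernel_eq emeasure_diff_minorized divide_ennreal_def mult.commute)
qed (auto simp: residual_def residual_kernel_def)

lemma sets_residual: "x \<in> space M \<Longrightarrow> sets (residual x) = sets M"
  by (cases "\<epsilon> < 1") (auto simp: residual_def residual_kernel_eq sets_kernel, auto simp: residual_kernel_def sets_kernel)

lemma prob_space_residual: "x \<in> space M \<Longrightarrow> prob_space (residual x)"
proof -
  assume x: "x \<in> space M"
  have "emeasure (residual x) (space (residual x)) = emeasure (residual x) (space M)"
    using sets_eq_imp_space_eq[OF sets_residual[OF x]] by simp
  also have "\<dots> = 1"
  proof -
    have "emeasure (K x) (space M) = 1" "emeasure \<beta> (space M) = 1"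
      using prob_space.emeasure_space_1[OF kernel_prob[OF x]]
        prob_space.emeasure_space_1[OF prob_space_\<beta>]
      sets_eq_imp_space_eq[OF sets_kernel[OF x]] space_\<beta> by auto
    moreover have "(1::ennreal) - ennreal \<epsilon> = ennreal (1 - \<epsilon>)"
      using eps_pos by (metis ennreal_1 ennreal_minus less_imp_le)
    ultimately show ?thesis
      using x by (auto simp: emeasure_residual)
  qed
  finally show ?thesis by (rule prob_spaceI)
qed

lemma measurable_residual [measurable]: "residual \<in> M \<rightarrow>\<^sub>M prob_algebra M"
proof (rule measurable_prob_algebraI)
  note [measurable] = S_sets measurable_prob_algebraD[OF kernel]
  show "residual \<in> M \<rightarrow>\<^sub>M subprob_algebra M"
  proof (rule measurable_subprob_algebra)
    fix A assume [measurable]: "A \<in> sets M"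
    show "(\<lambda>x. emeasure (residual x) A) \<in> borel_measurable M"
      by (subst measurable_cong[OF emeasure_residual]) simp_all
  qed (auto simp: sets_residual prob_space_residual prob_space_imp_subprob_space)
qed (rule prob_space_residual)

text \<open>\<open>L\<close> is the kernel of the chain killed at its regeneration, and \<open>h\<close> is the probability of regenerating
  in the next step, so that \<open>K = L + h \<otimes> \<beta>\<close>. In terms of the regeneration time,
  \<open>(L ^^ n) h x = \<P>(\<tau> = n + 1 | X\<^sub>0 = x)\<close> and \<open>(L ^^ n) 1 x = \<P>(\<tau> > n | X\<^sub>0 = x)\<close>.\<close>

definition L :: "('a \<Rightarrow> ennreal) \<Rightarrow> 'a \<Rightarrow> ennreal" where
  "L f x = (if x \<in> S then ennreal (1 - \<epsilon>) else 1) * (\<integral>\<^sup>+y. f y \<partial>residual x)"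

definition h :: "'a \<Rightarrow> ennreal" where
  "h x = ennreal \<epsilon> * indicator S x"

lemma measurable_h [measurable]: "h \<in> borel_measurable M"
  using S_sets unfolding h_def[abs_def] by measurable

lemma measurable_L [measurable]:
  assumes [measurable]: "f \<in> borel_measurable M"
  shows "L f \<in> borel_measurable M"
proof -
  note [measurable] = S_sets measurable_prob_algebraD[OF measurable_residual]
  show ?thesis
    unfolding L_def[abs_def] by measurable
qed

lemma measurable_L_funpow [measurable]: "f \<in> borel_measurable M \<Longrightarrow> (L ^^ n) f \<in> borel_measurable M"
  by (induction n) auto

lemma L_mono:
  assumes "\<And>x. x \<in> space M \<Longrightarrow> f x \<le> g x" "x \<in> space M"
  shows "L f x \<le> L g x"
  using assms unfolding L_def
  by (intro mult_left_mono nn_integral_mono) (auto simp: sets_eq_imp_space_eq[OF sets_residual])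

lemma L_funpow_mono:
  assumes "\<And>x. x \<in> space M \<Longrightarrow> f x \<le> g x" "x \<in> space M"
  shows "(L ^^ n) f x \<le> (L ^^ n) g x"
  using assms(2) by (induction n arbitrary: x) (use assms in \<open>auto intro: L_mono\<close>)

lemma L_funpow_cong:
  assumes "\<And>x. x \<in> space M \<Longrightarrow> f x = g x" "x \<in> space M"
  shows "(L ^^ n) f x = (L ^^ n) g x"
  using assms by (intro antisym L_funpow_mono) auto

lemma L_add:
  assumes "f \<in> borel_measurable M" "g \<in> borel_measurable M" "x \<in> space M"
  shows "L (\<lambda>x. f x + g x) x = L f x + L g x"
  using assms unfolding L_def
  by (subst nn_integral_add) (auto simp: measurable_cong_sets[OF sets_residual] distrib_left)

lemma L_cmult:
  assumes "f \<in> borel_measurable M" "x \<in> space M"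
  shows "L (\<lambda>x. f x * c) x = L f x * c"
  using assms unfolding L_def
  by (subst nn_integral_multc) (auto simp: measurable_cong_sets[OF sets_residual] mult_ac)

lemma L_funpow_add:
  assumes [measurable]: "f \<in> borel_measurable M" "g \<in> borel_measurable M" and x: "x \<in> space M"
  shows "(L ^^ n) (\<lambda>x. f x + g x) x = (L ^^ n) f x + (L ^^ n) g x"
  using x
proof (induction n arbitrary: x)
  case (Suc n)
  have "(L ^^ Suc n) (\<lambda>x. f x + g x) x = L (\<lambda>x. (L ^^ n) f x + (L ^^ n) g x) x"
    using L_funpow_cong[where n=1, OF Suc.IH Suc.prems] by simp
  with Suc.prems show ?case by (simp add: L_add)
qed simp

lemma L_funpow_cmult:
  assumes [measurable]: "f \<in> borel_measurable M" and x: "x \<in> space M"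
  shows "(L ^^ n) (\<lambda>x. f x * c) x = (L ^^ n) f x * c"
  using x
proof (induction n arbitrary: x)
  case (Suc n)
  have "(L ^^ Suc n) (\<lambda>x. f x * c) x = L (\<lambda>x. (L ^^ n) f x * c) x"
    using L_funpow_cong[where n=1, OF Suc.IH Suc.prems] by simp
  with Suc.prems show ?case by (simp add: L_cmult)
qed simp

text \<open>The identity \<open>K = L + h \<otimes> \<beta>\<close> behind every later
  decomposition: from a point of \<open>S\<close> the next state has law \<open>\<beta>\<close> with
  weight \<open>\<epsilon>\<close>.\<close>

lemma kernel_split:
  assumes x: "x \<in> space M" and f: "f \<in> borel_measurable M"
  shows "(\<integral>\<^sup>+y. f y \<partial>K x) = L f x + h x * (\<integral>\<^sup>+y. f y \<partial>\<beta>)"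
proof (cases "x \<in> S")
  case True
  interpret Kx: prob_space "K x" using x by (rule kernel_prob)
  interpret \<beta>: prob_space \<beta> by (rule prob_space_\<beta>)
  have spK: "space (K x) = space M"
    using sets_kernel[OF x] by (rule sets_eq_imp_space_eq)
  have "emeasure (K x) A = ennreal (1 - \<epsilon>) * emeasure (residual x) A + ennreal \<epsilon> * emeasure \<beta> A"
    if A: "A \<in> sets M" for A
  proof (cases "\<epsilon> < 1")
    case e: True
    have "ennreal (1 - \<epsilon>) * emeasure (residual x) A =
        (emeasure (K x) A - ennreal \<epsilon> * emeasure \<beta> A) * (ennreal (1 - \<epsilon>) / ennreal (1 - \<epsilon>))"
      using True e by (simp add: emeasure_residual[OF x A] divide_ennreal_def mult_ac)
    also have "\<dots> = emeasure (K x) A - ennreal \<epsilon> * emeasure \<beta> A"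
      using e by simp
    finally show ?thesis
      using minorized[OF True A] by (simp add: diff_add_cancel_ennreal)
  next
    case False
    with eps_le_1 have e: "\<epsilon> = 1" by simp
    \<comment> \<open>For \<open>\<epsilon> = 1\<close>, minorization of \<open>A\<close> and of its
      complement forces \<open>K x = \<beta>\<close>, both having mass 1; the residual law then has
      weight 0.\<close>
    have "Kx.prob A \<ge> \<beta>.prob A" "Kx.prob (space M - A) \<ge> \<beta>.prob (space M - A)"
      using minorized[OF True, of A] minorized[OF True, of "space M - A"] A
      by (auto simp: e Kx.emeasure_eq_measure \<beta>.emeasure_eq_measure)
    with A have "Kx.prob A = \<beta>.prob A"
      using Kx.prob_compl[of A] \<beta>.prob_compl[of A] by (simp add: sets_kernel[OF x] sets_\<beta> spK space_\<beta>)
    then show ?thesis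
      by (simp add: e Kx.emeasure_eq_measure \<beta>.emeasure_eq_measure)
  qed
  then show ?thesis
    using True f x
    by (subst nn_integral_combine[of "residual x" "K x" \<beta>])
       (auto simp: L_def h_def sets_residual sets_\<beta> sets_kernel measurable_cong_sets[OF sets_kernel])
qed (use x in \<open>simp add: L_def h_def residual_def\<close>)

section \<open>The split chain and the law of the regeneration time\<close>

definition coin :: "bool measure" where
  "coin = measure_pmf (bernoulli_pmf \<epsilon>)"

definition split_space :: "('a \<times> bool) measure" where
  "split_space = M \<Otimes>\<^sub>M count_space UNIV"

text \<open>The law of the next state given the current state and its toss; the split kernel pairs
  it with a fresh toss.\<close>

definition next_law :: "'a \<times> bool \<Rightarrow> 'a measure" where
  "next_law z = (if fst z \<in> S \<and> snd z then \<beta> else residual (fst z))"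

text \<open>Averaging over the current toss brings functions on the split space back to functions on
  \<open>M\<close>. It intertwines the killed split kernel with \<open>L\<close>.\<close>

definition coin_avg :: "('a \<times> bool \<Rightarrow> ennreal) \<Rightarrow> 'a \<Rightarrow> ennreal" where
  "coin_avg f x = (\<integral>\<^sup>+b. f (x, b) \<partial>coin)"

lemma coin_avg_eq: "coin_avg f x = ennreal \<epsilon> * f (x, True) + ennreal (1 - \<epsilon>) * f (x, False)"
  using eps_pos eps_le_1 by (simp add: coin_avg_def coin_def mult.commute)

lemma space_split_space: "z \<in> space split_space \<longleftrightarrow> fst z \<in> space M"
  by (cases z) (simp add: split_space_def space_pair_measure)

lemma split_kernel_eq: "split_kernel K S \<epsilon> \<beta> z = next_law z \<Otimes>\<^sub>M coin"
  by (cases z) (simp add: split_kernel_def next_law_def coin_def residual_def)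

lemma coin_prob: "coin \<in> space (prob_algebra (count_space UNIV))"
  by (simp add: space_prob_algebra coin_def prob_space_measure_pmf)

lemma measurable_regen: "Measurable.pred split_space (\<lambda>z. fst z \<in> S \<and> snd z)"
  unfolding split_space_def using S_sets by measurable

lemma measurable_next_law: "next_law \<in> split_space \<rightarrow>\<^sub>M prob_algebra M"
proof -
  have [measurable]: "(\<lambda>z. residual (fst z)) \<in> split_space \<rightarrow>\<^sub>M prob_algebra M"
    unfolding split_space_def by measurable
  show ?thesis
    unfolding next_law_def[abs_def] using beta_prob measurable_regen by measurable
qed

lemma measurable_split_kernel: "split_kernel K S \<epsilon> \<beta> \<in> split_space \<rightarrow>\<^sub>M prob_algebra split_space"
proof -
  have "(\<lambda>z. next_law z \<Otimes>\<^sub>M coin) \<in> split_space \<rightarrow>\<^sub>M prob_algebra (M \<Otimes>\<^sub>M count_space UNIV)"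
    using measurable_next_law coin_prob by (intro measurable_pair_prob) auto
  then show ?thesis
    by (simp add: split_kernel_eq[abs_def] split_space_def)
qed

lemma nn_integral_pair_coin:
  assumes "sets N = sets M" and [measurable]: "f \<in> borel_measurable split_space"
  shows "(\<integral>\<^sup>+z. f z \<partial>(N \<Otimes>\<^sub>M coin)) = (\<integral>\<^sup>+x. coin_avg f x \<partial>N)"
proof -
  interpret coin: prob_space coin
    by (simp add: coin_def prob_space_measure_pmf)
  have "sets (N \<Otimes>\<^sub>M coin) = sets split_space"
    unfolding split_space_def using assms by (intro sets_pair_measure_cong) (auto simp: coin_def)
  from measurable_cong_sets[OF this refl] have "f \<in> borel_measurable (N \<Otimes>\<^sub>M coin)"
    using assms(2) by blast
  then show ?thesis
    by (subst coin.nn_integral_fst[symmetric]) (auto simp: coin_avg_def[abs_def])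
qed

lemma measurable_coin_avg [measurable]:
  assumes [measurable]: "f \<in> borel_measurable split_space"
  shows "coin_avg f \<in> borel_measurable M"
proof -
  have [measurable]: "(\<lambda>x. f (x, b)) \<in> borel_measurable M" for b
    by (rule measurable_compose[OF _ assms]) (simp add: split_space_def)
  show ?thesis
    unfolding coin_avg_eq[abs_def] by measurable
qed

definition regen :: "('a \<times> bool) set" where
  "regen = {z \<in> space split_space. fst z \<in> S \<and> snd z}"

definition no_regen :: "('a \<times> bool) set" where
  "no_regen = {z \<in> space split_space. \<not> (fst z \<in> S \<and> snd z)}"

lemma regen_sets: "regen \<in> sets split_space" and no_regen_sets: "no_regen \<in> sets split_space"
  using measurable_regen sets.sets_Collect_neg[OF measurable_regen[unfolded pred_def]]
  by (auto simp: pred_def regen_def no_regen_def)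

text \<open>On \<open>S\<close> a successful toss is killed and a failed one survives with weight
  \<open>1 - \<epsilon>\<close>. Off \<open>S\<close> both tosses survive and the weights add up to
  1. In either case the surviving mass moves by \<open>residual\<close>, which is the action of
  \<open>L\<close>.\<close>

lemma coin_avg_kill:
  assumes f: "f \<in> borel_measurable split_space" and x: "x \<in> space M"
  shows "coin_avg (kill (split_kernel K S \<epsilon> \<beta>) no_regen f) x = L (coin_avg f) x"
proof -
  have "sets (next_law z) = sets M" if "z \<in> space split_space" for z
    using measurable_space[OF measurable_next_law that] by (simp add: space_prob_algebra)
  then have "kill (split_kernel K S \<epsilon> \<beta>) no_regen f (x, b) =
      indicator no_regen (x, b) * (\<integral>\<^sup>+y. coin_avg f y \<partial>next_law (x, b))" for b
    using x by (simp add: kill_def split_kernel_eq nn_integral_pair_coin[OF _ f] space_split_space)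
  moreover have "ennreal \<epsilon> * c + ennreal (1 - \<epsilon>) * c = c" for c
    using eps_pos eps_le_1
    by (simp add: distrib_right[symmetric] ennreal_plus[symmetric] del: ennreal_plus)
  ultimately show ?thesis
    using x
    by (simp add: coin_avg_eq[of "kill _ _ _"] L_def next_law_def space_split_space no_regen_def)
qed

lemma coin_avg_kill_funpow:
  assumes f: "f \<in> borel_measurable split_space" and x: "x \<in> space M"
  shows "coin_avg ((kill (split_kernel K S \<epsilon> \<beta>) no_regen ^^ n) f) x = (L ^^ n) (coin_avg f) x"
  using x
proof (induction n arbitrary: x)
  case (Suc n)
  have "coin_avg ((kill (split_kernel K S \<epsilon> \<beta>) no_regen ^^ Suc n) f) x =
      L (coin_avg ((kill (split_kernel K S \<epsilon> \<beta>) no_regen ^^ n) f)) x"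
    using Suc.prems
    by (simp add: coin_avg_kill measurable_kill_funpow measurable_split_kernel no_regen_sets f)
  also have "\<dots> = L ((L ^^ n) (coin_avg f)) x"
    using L_funpow_cong[where n=1, OF Suc.IH Suc.prems] by simp
  finally show ?case by simp
qed simp

text \<open>The event \<open>\<tau> = n + 1\<close> says that the first \<open>n\<close> pairs lie
  in \<open>no_regen\<close> and the next one in \<open>regen\<close>. The path formula gives powers
  of the killed split kernel, and averaging over the coins turns them into powers of
  \<open>L\<close> applied to \<open>h\<close>.\<close>

lemma tau_prob_Suc:
  assumes \<mu>: "\<mu> \<in> space (prob_algebra M)"
  shows "ennreal (tau_prob M K S \<epsilon> \<beta> \<mu> (Suc n)) = (\<integral>\<^sup>+x. (L ^^ n) h x \<partial>\<mu>)"
proof -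
  let ?K = "split_kernel K S \<epsilon> \<beta>" and ?\<mu> = "\<mu> \<Otimes>\<^sub>M coin"
  let ?C = "chain_law split_space ?K ?\<mu>"
  have s\<mu>: "sets \<mu> = sets M" using \<mu> by (simp add: space_prob_algebra)
  \<comment> \<open>The initial law is viewed as a constant kernel on a one-point space, so that
    measurability of products of kernels shows it to be a probability measure on the split
    space.\<close>
  have "(\<lambda>_. \<mu> \<Otimes>\<^sub>M coin) \<in> count_space {()} \<rightarrow>\<^sub>M prob_algebra (M \<Otimes>\<^sub>M count_space UNIV)"
    using \<mu> coin_prob by (intro measurable_pair_prob) auto
  from measurable_space[OF this, of "()"] have \<mu>': "?\<mu> \<in> space (prob_algebra split_space)"
    by (simp add: split_space_def)
  note chain = measurable_split_kernel \<mu>'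
  interpret C: prob_space ?C
    by (rule prob_space_chain_law[OF chain])
  have C: "split_law M K S \<epsilon> \<beta> \<mu> = ?C"
    by (simp add: split_law_def split_space_def coin_def)
  have "{\<omega> \<in> space ?C. tau S \<omega> = enat (Suc n)} =
      {\<omega> \<in> space ?C. (\<forall>k<n. \<omega> k \<in> no_regen) \<and> \<omega> n \<in> regen}"
    using sets_eq_imp_space_eq[OF sets_chain_law[OF chain]]
    by (auto simp: tau_eq_Suc_iff space_PiM regen_def no_regen_def)
  then have "ennreal (tau_prob M K S \<epsilon> \<beta> \<mu> (Suc n)) =
      (\<integral>\<^sup>+z. (kill ?K no_regen ^^ n) (indicator regen) z \<partial>?\<mu>)"
    by (simp add: tau_prob_def C C.emeasure_eq_measure[symmetric] emeasure_chain_law[OF chain no_regen_sets regen_sets])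
  also have "\<dots> = (\<integral>\<^sup>+x. coin_avg ((kill ?K no_regen ^^ n) (indicator regen)) x \<partial>\<mu>)"
    using s\<mu> chain no_regen_sets regen_sets
    by (intro nn_integral_pair_coin measurable_kill_funpow) auto
  also have "\<dots> = (\<integral>\<^sup>+x. (L ^^ n) h x \<partial>\<mu>)"
  proof (rule nn_integral_cong)
    fix x assume "x \<in> space \<mu>"
    then have x: "x \<in> space M" using sets_eq_imp_space_eq[OF s\<mu>] by simp
    have "coin_avg (indicator regen) x = h x" if "x \<in> space M" for x
      using that by (auto simp: coin_avg_eq h_def regen_def space_split_space split: split_indicator)
    then show "coin_avg ((kill ?K no_regen ^^ n) (indicator regen)) x = (L ^^ n) h x"
      unfolding coin_avg_kill_funpow[OF borel_measurable_indicator[OF regen_sets] x]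
      using x by (rule L_funpow_cong)
  qed
  finally show ?thesis .
qed

lemma tau_prob_0: "tau_prob M K S \<epsilon> \<beta> \<mu> 0 = 0"
  by (simp add: tau_prob_def tau_nonzero)

lemma tau_prob_nonneg: "0 \<le> tau_prob M K S \<epsilon> \<beta> \<mu> n"
  by (simp add: tau_prob_def)

section \<open>Survival probabilities and almost sure regeneration\<close>

lemma L_one:
  assumes x: "x \<in> space M"
  shows "1 = L (\<lambda>_. 1) x + h x"
  using kernel_split[OF x, of "\<lambda>_. 1"] prob_space.emeasure_space_1[OF kernel_prob[OF x]]
    prob_space.emeasure_space_1[OF prob_space_\<beta>] by simp

text \<open>Apply the \<open>n\<close>-th power of \<open>L\<close> to \<open>1 = L 1 + h\<close>:
  survival beyond time \<open>n\<close> means survival beyond \<open>n + 1\<close> or regeneration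
  with \<open>\<tau> = n + 1\<close>.\<close>

lemma L_funpow_one_split:
  assumes x: "x \<in> space M"
  shows "(L ^^ n) (\<lambda>_. 1) x = (L ^^ Suc n) (\<lambda>_. 1) x + (L ^^ n) h x"
proof -
  have "(L ^^ n) (\<lambda>_. 1) x = (L ^^ n) (\<lambda>x. L (\<lambda>_. 1) x + h x) x"
    using L_one x by (rule L_funpow_cong)
  also have "\<dots> = (L ^^ n) (L (\<lambda>_. 1)) x + (L ^^ n) h x"
    using x by (intro L_funpow_add) measurable
  also have "(L ^^ n) (L (\<lambda>_. 1)) x = (L ^^ Suc n) (\<lambda>_. 1) x"
    by (simp only: funpow_Suc_right o_apply)
  finally show ?thesis .
qed

lemma L_funpow_one_decreasing:
  assumes x: "x \<in> space M"
  shows "(L ^^ Suc n) (\<lambda>_. 1) x \<le> (L ^^ n) (\<lambda>_. 1) x"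
  unfolding L_funpow_one_split[OF x, of n] by (rule add_increasing2) simp_all

lemma L_funpow_one_le:
  assumes x: "x \<in> space M"
  shows "(L ^^ n) (\<lambda>_. 1) x \<le> 1"
proof (induction n)
  case (Suc n)
  with L_funpow_one_decreasing[OF x, of n] show ?case
    by (rule order_trans)
qed simp

lemma L_funpow_one_sum:
  assumes x: "x \<in> space M"
  shows "(L ^^ n) (\<lambda>_. 1) x = (L ^^ (m + n)) (\<lambda>_. 1) x + (\<Sum>k<m. (L ^^ (k + n)) h x)"
proof (induction m)
  case (Suc m)
  have "(L ^^ n) (\<lambda>_. 1) x =
      ((L ^^ (Suc m + n)) (\<lambda>_. 1) x + (L ^^ (m + n)) h x) + (\<Sum>k<m. (L ^^ (k + n)) h x)"
    unfolding add_Suc L_funpow_one_split[OF x, of "m + n", symmetric] by (rule Suc.IH)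
  then show ?case
    by (simp only: sum.lessThan_Suc add_ac)
qed simp

text \<open>The powers are the probabilities of avoiding \<open>S\<close> before time
  \<open>n\<close>. These events decrease to the event of never visiting \<open>S\<close>, which is
  null by recurrence.\<close>

lemma avoid_S_tendsto_0:
  assumes x: "x \<in> space M"
  shows "(\<lambda>n. (kill K (space M - S) ^^ n) (\<lambda>_. 1) x) \<longlonglongrightarrow> 0"
proof -
  note chain = kernel return_in_prob_algebra[OF x]
  have A: "space M - S \<in> sets M"
    using S_sets by (rule sets.compl_sets)
  let ?C = "chain_law M K (return M x)"
  interpret C: prob_space ?C by (rule prob_space_chain_law[OF chain])
  note sC = sets_chain_law[OF chain]
  note spC = sets_eq_imp_space_eq[OF sC]
  define E where "E n = {\<omega> \<in> space ?C. (\<forall>k<n. \<omega> k \<in> space M - S) \<and> \<omega> n \<in> space M}" for n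
  have E: "E n \<in> sets ?C" for n
  proof -
    have [measurable]: "(\<lambda>\<omega>. \<omega> k) \<in> ?C \<rightarrow>\<^sub>M M" for k
      by (simp add: measurable_cong_sets[OF sC refl])
    have [measurable]: "S \<in> sets M" by (rule S_sets)
    have "E n = {\<omega> \<in> space ?C. (\<forall>k\<in>{..<n}. \<omega> k \<in> space M - S) \<and> \<omega> n \<in> space M}"
      by (auto simp: E_def)
    also have "\<dots> \<in> sets ?C" by measurable
    finally show ?thesis .
  qed
  have eq: "emeasure ?C (E n) = (kill K (space M - S) ^^ n) (\<lambda>_. 1) x" for n
  proof -
    have m: "(kill K (space M - S) ^^ n) (indicator (space M)) \<in> borel_measurable M"
      using kernel A by (intro measurable_kill_funpow) auto
    have "emeasure ?C (E n) = (kill K (space M - S) ^^ n) (indicator (space M)) x"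
      unfolding E_def emeasure_chain_law[OF chain A sets.top] using m x by (simp add: nn_integral_return)
    also have "\<dots> = (kill K (space M - S) ^^ n) (\<lambda>_. 1) x"
      using x
    proof (induction n arbitrary: x)
      case (Suc n)
      then show ?case
        using sets_eq_imp_space_eq[OF sets_kernel[OF Suc.prems]] by (auto intro!: kill_cong)
    qed simp
    finally show ?thesis .
  qed
  have "decseq E"
    by (auto simp: decseq_def E_def spC space_PiM)
  with E have lim: "(\<lambda>n. C.prob (E n)) \<longlonglongrightarrow> C.prob (\<Inter>n. E n)"
    by (intro C.finite_Lim_measure_decseq) auto
  let ?R = "{\<omega> \<in> space ?C. \<exists>\<^sub>\<infinity>n. \<omega> n \<in> S}"
  \<comment> \<open>A set that is not measurable has \<open>measure\<close> 0 by convention, so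
    probability 1 in the recurrence hypothesis already entails measurability.\<close>
  have R: "?R \<in> sets ?C"
  proof (rule ccontr)
    assume "?R \<notin> sets ?C"
    then have "C.prob ?R = 0" by (rule measure_notin_sets)
    with recurrent[OF x] show False by simp
  qed
  have "(\<Inter>n. E n) \<subseteq> space ?C - ?R"
  proof
    fix \<omega> assume \<omega>: "\<omega> \<in> (\<Inter>n. E n)"
    then have "\<omega> \<in> E (Suc k)" for k by blast
    from this[of k for k] have "\<omega> k \<notin> S" "\<omega> \<in> space ?C" for k
      unfolding E_def by blast+
    then show "\<omega> \<in> space ?C - ?R"
      by (simp add: INFM_nat)
  qed
  moreover have "C.prob (space ?C - ?R) = 0"
    using recurrent[OF x] R by (subst C.prob_compl) auto
  ultimately have "C.prob (\<Inter>n. E n) = 0"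
    using R C.finite_measure_mono[of "\<Inter>n. E n" "space ?C - ?R"] by (simp add: measure_le_0_iff)
  with lim have "(\<lambda>n. ennreal (C.prob (E n))) \<longlonglongrightarrow> ennreal 0"
    by (intro tendsto_ennrealI) simp
  then show ?thesis
    by (simp add: C.emeasure_eq_measure[symmetric] eq)
qed

text \<open>Let \<open>w\<close> be the probability of never regenerating and \<open>s\<close> its supremum. At the first visit to \<open>S\<close>, which
  occurs almost surely, the coin toss fails with probability \<open>1 - \<epsilon>\<close>; hence \<open>s \<le> (1 - \<epsilon>) s\<close> and \<open>s = 0\<close>.\<close>

lemma L_funpow_one_tendsto_0:
  assumes x: "x \<in> space M"
  shows "(\<lambda>n. (L ^^ n) (\<lambda>_. 1) x) \<longlonglongrightarrow> 0"
proof -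
  define w where "w x = (INF n. (L ^^ n) (\<lambda>_. 1) x)" for x
  have dec: "(L ^^ Suc n) (\<lambda>_. 1) x \<le> (L ^^ n) (\<lambda>_. 1) x" if "x \<in> space M" for n x
    using that by (rule L_funpow_one_decreasing)
  then have lim: "(\<lambda>n. (L ^^ n) (\<lambda>_. 1) x) \<longlonglongrightarrow> w x" if "x \<in> space M" for x
    unfolding w_def using that by (intro LIMSEQ_INF decseq_SucI)
  have [measurable]: "w \<in> borel_measurable M"
    unfolding w_def[abs_def] by measurable
  have w_le: "w x \<le> 1" if "x \<in> space M" for x
    unfolding w_def using that by (intro INF_lower2[of 0]) auto
  \<comment> \<open>Decreasing monotone convergence applies because the functions are at most 1 and
    the residual law has finite mass.\<close>
  have Lw: "w x = L w x" if x: "x \<in> space M" for x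
  proof -
    note spr = sets_eq_imp_space_eq[OF sets_residual[OF x]]
    interpret rx: prob_space "residual x" using x by (rule prob_space_residual)
    have Inf: "(\<integral>\<^sup>+y. w y \<partial>residual x) = (INF n. \<integral>\<^sup>+y. (L ^^ n) (\<lambda>_. 1) y \<partial>residual x)"
      unfolding w_def
    proof (rule nn_integral_monotone_convergence_INF_AE')
      show "(L ^^ n) (\<lambda>_. 1) \<in> borel_measurable (residual x)" for n
        by (simp add: measurable_cong_sets[OF sets_residual[OF x] refl])
      show "AE y in residual x. (L ^^ Suc n) (\<lambda>_. 1) y \<le> (L ^^ n) (\<lambda>_. 1) y" for n
        using dec by (intro AE_I2) (auto simp: spr)
    qed (simp add: rx.emeasure_space_1)
    have "decseq (\<lambda>n. \<integral>\<^sup>+y. (L ^^ n) (\<lambda>_. 1) y \<partial>residual x)"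
      using dec by (intro decseq_SucI nn_integral_mono) (auto simp: spr)
    from LIMSEQ_INF[OF this] have "(\<lambda>n. \<integral>\<^sup>+y. (L ^^ n) (\<lambda>_. 1) y \<partial>residual x) \<longlonglongrightarrow> (\<integral>\<^sup>+y. w y \<partial>residual x)"
      unfolding Inf .
    then have "(\<lambda>n. (L ^^ Suc n) (\<lambda>_. 1) x) \<longlonglongrightarrow> L w x"
      unfolding funpow.simps o_def L_def by (intro ennreal_tendsto_cmult) auto
    with lim[OF x, THEN LIMSEQ_Suc] show ?thesis
      by (rule LIMSEQ_unique)
  qed
  define s where "s = (SUP x\<in>space M. w x)"
  have w_s: "w x \<le> s" if "x \<in> space M" for x
    unfolding s_def using that by (rule SUP_upper)
  have s_le: "s \<le> 1"
    unfolding s_def using w_le by (rule SUP_least)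
  let ?v = "\<lambda>n. (kill K (space M - S) ^^ n) (\<lambda>_. 1)"
  have v_meas: "?v n \<in> borel_measurable M" for n
    using kernel S_sets by (intro measurable_kill_funpow) auto
  \<comment> \<open>Induction over the time allowed for reaching \<open>S\<close>. At a point of
    \<open>S\<close> one application of \<open>L\<close> costs the factor
    \<open>1 - \<epsilon>\<close>; off \<open>S\<close>, \<open>L\<close> is integration against
    \<open>K\<close> and the bound is propagated. \<open>?v n\<close> accounts for paths that have
    not yet met \<open>S\<close>.\<close>
  have w_v: "w x \<le> ennreal (1 - \<epsilon>) * s + s * ?v n x" if "x \<in> space M" for x n
    using that
  proof (induction n arbitrary: x)
    case 0
    then show ?case using w_s[of x] by (simp add: add_increasing)
  next
    case (Suc n)
    show ?case
    proof (cases "x \<in> S")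
      case True
      interpret rx: prob_space "residual x" using Suc.prems by (rule prob_space_residual)
      have "(\<integral>\<^sup>+y. w y \<partial>residual x) \<le> (\<integral>\<^sup>+y. s \<partial>residual x)"
        using w_s sets_eq_imp_space_eq[OF sets_residual[OF Suc.prems]] by (intro nn_integral_mono) auto
      then have "(\<integral>\<^sup>+y. w y \<partial>residual x) \<le> s"
        by (simp add: rx.emeasure_space_1)
      then have "w x \<le> ennreal (1 - \<epsilon>) * s"
        using True by (subst Lw[OF Suc.prems]) (simp add: L_def mult_left_mono)
      then show ?thesis by (simp add: add_increasing2)
    next
      case False
      interpret Kx: prob_space "K x" using Suc.prems by (rule kernel_prob)
      note spK = sets_kernel[OF Suc.prems]
      have "w x = (\<integral>\<^sup>+y. w y \<partial>K x)"
        using False by (subst Lw[OF Suc.prems]) (simp add: L_def residual_def)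
      also have "\<dots> \<le> (\<integral>\<^sup>+y. ennreal (1 - \<epsilon>) * s + s * ?v n y \<partial>K x)"
        using Suc.IH sets_eq_imp_space_eq[OF spK] by (intro nn_integral_mono) auto
      also have "\<dots> = ennreal (1 - \<epsilon>) * s + s * (\<integral>\<^sup>+y. ?v n y \<partial>K x)"
        using v_meas by (simp add: nn_integral_add nn_integral_cmult measurable_cong_sets[OF spK refl] Kx.emeasure_space_1)
      also have "(\<integral>\<^sup>+y. ?v n y \<partial>K x) = ?v (Suc n) x"
        using False Suc.prems by (simp add: kill_def[of K _ "?v n"])
      finally show ?thesis .
    qed
  qed
  have "w x \<le> ennreal (1 - \<epsilon>) * s" if x: "x \<in> space M" for x
  proof -
    \<comment> \<open>Multiplication in \<open>ennreal\<close> passes to the limit 0 because the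
      factor \<open>s\<close> is finite.\<close>
    have "(\<lambda>n. ennreal (1 - \<epsilon>) * s + s * ?v n x) \<longlonglongrightarrow> ennreal (1 - \<epsilon>) * s + s * 0"
      using s_le by (intro tendsto_add tendsto_const ennreal_tendsto_cmult avoid_S_tendsto_0 x)
        (auto simp: less_top[symmetric] top_unique)
    then show ?thesis
      using w_v[OF x] by (intro LIMSEQ_le_const[of _ "ennreal (1 - \<epsilon>) * s"]) auto
  qed
  then have le: "s \<le> ennreal (1 - \<epsilon>) * s"
    unfolding s_def by (rule SUP_least)
  obtain r where r: "s = ennreal r" "0 \<le> r"
    using s_le by (cases s) (auto simp: top_unique)
  with le have "r \<le> (1 - \<epsilon>) * r"
    using eps_le_1 by (simp add: ennreal_mult[symmetric])
  then have "\<epsilon> * r \<le> 0" by (simp add: algebra_simps)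
  with r eps_pos have "s = 0"
    by (simp add: mult_le_0_iff)
  with w_s[OF x] have "w x = 0"
    by simp
  then show ?thesis
    by (rule subst[where P="\<lambda>y. _ \<longlonglongrightarrow> y"]) (rule lim[OF x])
qed

text \<open>Let \<open>m\<close> tend to infinity in \<open>L_funpow_one_sum\<close>: almost sure
  regeneration makes the remainder vanish, so survival beyond \<open>n\<close> is the sum of all
  later regeneration probabilities.\<close>

lemma L_funpow_one_suminf:
  assumes x: "x \<in> space M"
  shows "(L ^^ n) (\<lambda>_. 1) x = (\<Sum>k. (L ^^ (k + n)) h x)"
proof -
  have "(\<lambda>m. (L ^^ (m + n)) (\<lambda>_. 1) x) \<longlonglongrightarrow> 0"
    using L_funpow_one_tendsto_0[OF x] by (rule LIMSEQ_ignore_initial_segment)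
  moreover have "(\<lambda>m. \<Sum>k<m. (L ^^ (k + n)) h x) \<longlonglongrightarrow> (\<Sum>k. (L ^^ (k + n)) h x)"
    by (rule summable_LIMSEQ[OF summableI])
  ultimately have "(\<lambda>m. (L ^^ (m + n)) (\<lambda>_. 1) x + (\<Sum>k<m. (L ^^ (k + n)) h x)) \<longlonglongrightarrow>
      0 + (\<Sum>k. (L ^^ (k + n)) h x)"
    by (rule tendsto_add)
  moreover have "(\<lambda>m. (L ^^ (m + n)) (\<lambda>_. 1) x + (\<Sum>k<m. (L ^^ (k + n)) h x)) =
      (\<lambda>m. (L ^^ n) (\<lambda>_. 1) x)"
    unfolding L_funpow_one_sum[OF x, symmetric] ..
  ultimately show ?thesis
    by (simp only: LIMSEQ_const_iff add_0_left)
qed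

section \<open>Mixing of the chain started from the regeneration measure\<close>

definition kernel_op :: "('a \<Rightarrow> ennreal) \<Rightarrow> 'a \<Rightarrow> ennreal" where
  "kernel_op f x = (\<integral>\<^sup>+y. f y \<partial>K x)"

lemma measurable_kernel_op [measurable]:
  assumes [measurable]: "f \<in> borel_measurable M"
  shows "kernel_op f \<in> borel_measurable M"
proof -
  note [measurable] = measurable_prob_algebraD[OF kernel]
  show ?thesis
    unfolding kernel_op_def[abs_def] by measurable
qed

lemma measurable_kernel_op_funpow [measurable]: "f \<in> borel_measurable M \<Longrightarrow> (kernel_op ^^ n) f \<in> borel_measurable M"
  by (induction n) auto

lemma kernel_op_funpow_le_1:
  assumes "\<And>x. x \<in> space M \<Longrightarrow> f x \<le> 1" "x \<in> space M"
  shows "(kernel_op ^^ n) f x \<le> 1"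
  using assms(2)
proof (induction n arbitrary: x)
  case (Suc n)
  interpret Kx: prob_space "K x" using Suc.prems by (rule kernel_prob)
  have "kernel_op ((kernel_op ^^ n) f) x \<le> (\<integral>\<^sup>+y. 1 \<partial>K x)"
    unfolding kernel_op_def[of "(kernel_op ^^ n) f"] using Suc.IH sets_eq_imp_space_eq[OF sets_kernel[OF Suc.prems]]
    by (intro nn_integral_mono) auto
  then show ?case by (simp add: Kx.emeasure_space_1)
qed (use assms in auto)

lemma kernel_op_eq:
  assumes "f \<in> borel_measurable M" "x \<in> space M"
  shows "kernel_op f x = L f x + h x * (\<integral>\<^sup>+y. f y \<partial>\<beta>)"
  unfolding kernel_op_def using assms by (intro kernel_split)

lemma L_funpow_kernel_op:
  assumes [measurable]: "f \<in> borel_measurable M" and x: "x \<in> space M"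
  shows "(L ^^ n) (kernel_op f) x = (L ^^ Suc n) f x + (L ^^ n) h x * (\<integral>\<^sup>+y. f y \<partial>\<beta>)"
proof -
  have "(L ^^ n) (kernel_op f) x = (L ^^ n) (\<lambda>x. L f x + h x * (\<integral>\<^sup>+y. f y \<partial>\<beta>)) x"
    using kernel_op_eq[OF assms(1)] x by (rule L_funpow_cong)
  also have "\<dots> = (L ^^ n) (L f) x + (L ^^ n) (\<lambda>x. h x * (\<integral>\<^sup>+y. f y \<partial>\<beta>)) x"
    using x by (intro L_funpow_add) measurable
  also have "(L ^^ n) (\<lambda>x. h x * (\<integral>\<^sup>+y. f y \<partial>\<beta>)) x = (L ^^ n) h x * (\<integral>\<^sup>+y. f y \<partial>\<beta>)"
    using x by (intro L_funpow_cmult) measurable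
  finally show ?thesis
    by (simp only: funpow_Suc_right o_apply)
qed

text \<open>Decomposition at the first regeneration: either there is none in the first
  \<open>m\<close> steps, or \<open>\<tau> = k + 1 \<le> m\<close> and the chain restarts from
  \<open>\<beta>\<close> with the remaining steps. In the induction \<open>n\<close> varies, so that
  the extra step can be absorbed into it.\<close>

lemma kernel_op_funpow_decomp:
  assumes f[measurable]: "f \<in> borel_measurable M" and x: "x \<in> space M"
  shows "(kernel_op ^^ (m + n)) f x = (L ^^ m) ((kernel_op ^^ n) f) x +
    (\<Sum>k<m. (L ^^ k) h x * (\<integral>\<^sup>+y. (kernel_op ^^ (m - Suc k + n)) f y \<partial>\<beta>))"
proof (induction m arbitrary: n)
  case (Suc m)
  have "(kernel_op ^^ (Suc m + n)) f x = (kernel_op ^^ (m + Suc n)) f x"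
    by simp
  also have "\<dots> = (L ^^ m) (kernel_op ((kernel_op ^^ n) f)) x +
      (\<Sum>k<m. (L ^^ k) h x * (\<integral>\<^sup>+y. (kernel_op ^^ (m - Suc k + Suc n)) f y \<partial>\<beta>))"
    unfolding Suc.IH[of "Suc n"] by simp
  also have "(L ^^ m) (kernel_op ((kernel_op ^^ n) f)) x =
      (L ^^ Suc m) ((kernel_op ^^ n) f) x + (L ^^ m) h x * (\<integral>\<^sup>+y. (kernel_op ^^ n) f y \<partial>\<beta>)"
    using x by (intro L_funpow_kernel_op) measurable
  also have "(\<Sum>k<m. (L ^^ k) h x * (\<integral>\<^sup>+y. (kernel_op ^^ (m - Suc k + Suc n)) f y \<partial>\<beta>)) =
      (\<Sum>k<m. (L ^^ k) h x * (\<integral>\<^sup>+y. (kernel_op ^^ (Suc m - Suc k + n)) f y \<partial>\<beta>))"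
    by (intro sum.cong refl) (simp add: Suc_diff_Suc[symmetric] del: funpow.simps)
  finally show ?case
    by (simp add: add_ac del: funpow.simps)
qed simp

text \<open>Duality between the action of \<open>K\<close> on measures and on functions; it reduces
  the claim to estimates for iterates of \<open>kernel_op\<close>.\<close>

lemma transition_op_funpow:
  assumes \<mu>: "\<mu> \<in> space (prob_algebra M)"
  shows "(transition_op K ^^ n) \<mu> \<in> space (prob_algebra M)"
    and "f \<in> borel_measurable M \<Longrightarrow> (\<integral>\<^sup>+x. f x \<partial>(transition_op K ^^ n) \<mu>) = (\<integral>\<^sup>+x. (kernel_op ^^ n) f x \<partial>\<mu>)"
proof -
  show *: "(transition_op K ^^ n) \<mu> \<in> space (prob_algebra M)" for n
  proof (induction n)
    case (Suc n)
    then have "(transition_op K ^^ n) \<mu> \<bind> K \<in> space (prob_algebra M)"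
      using prob_space_bind'[OF Suc kernel] sets_bind'[OF Suc kernel] by (simp add: space_prob_algebra)
    then show ?case by (simp add: transition_op_def[of K "(transition_op K ^^ n) \<mu>"])
  qed (use \<mu> in simp)
  show "f \<in> borel_measurable M \<Longrightarrow> (\<integral>\<^sup>+x. f x \<partial>(transition_op K ^^ n) \<mu>) = (\<integral>\<^sup>+x. (kernel_op ^^ n) f x \<partial>\<mu>)"
  proof (induction n arbitrary: f)
    case (Suc n)
    let ?\<nu> = "(transition_op K ^^ n) \<mu>"
    have "sets ?\<nu> = sets M" using *[of n] by (simp add: space_prob_algebra)
    then have "K \<in> ?\<nu> \<rightarrow>\<^sub>M subprob_algebra M"
      using measurable_prob_algebraD[OF kernel] measurable_cong_sets[of ?\<nu> M] by blast
    then have "(\<integral>\<^sup>+x. f x \<partial>transition_op K ?\<nu>) = (\<integral>\<^sup>+x. kernel_op f x \<partial>?\<nu>)"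
      unfolding transition_op_def kernel_op_def using Suc.prems by (intro nn_integral_bind)
    also have "\<dots> = (\<integral>\<^sup>+x. (kernel_op ^^ n) (kernel_op f) x \<partial>\<mu>)"
      using Suc.prems by (intro Suc.IH) measurable
    finally show ?case
      by (simp only: funpow.simps(2) o_apply funpow_swap1)
  qed simp
qed

section \<open>The model chain as the age since the last regeneration\<close>

definition p :: "nat \<Rightarrow> real" where
  "p = tau_prob M K S \<epsilon> \<beta> \<beta>"

lemma p_nonneg: "0 \<le> p n"
  by (simp add: p_def tau_prob_nonneg)

lemma p_Suc: "ennreal (p (Suc n)) = (\<integral>\<^sup>+x. (L ^^ n) h x \<partial>\<beta>)"
  unfolding p_def by (rule tau_prob_Suc[OF beta_prob])

lemma measurable_\<beta>_iff: "f \<in> borel_measurable \<beta> \<longleftrightarrow> f \<in> borel_measurable M"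
  using measurable_cong_sets[OF sets_\<beta> refl] by blast

text \<open>Integrating the series for the survival probability against \<open>\<beta>\<close> shows
  that the tail sum is the probability of \<open>\<tau> > n\<close> for the chain started from
  \<open>\<beta>\<close>.\<close>

lemma tail_sum_p: "ennreal (tail_sum p n) = (\<integral>\<^sup>+x. (L ^^ n) (\<lambda>_. 1) x \<partial>\<beta>)"
  and summable_p: "summable (\<lambda>k. p (Suc (k + n)))"
  and tail_sum_eq: "tail_sum p n = (\<Sum>k. p (Suc (k + n)))"
proof -
  interpret \<beta>: prob_space \<beta> by (rule prob_space_\<beta>)
  have "(\<integral>\<^sup>+x. (L ^^ n) (\<lambda>_. 1) x \<partial>\<beta>) = (\<integral>\<^sup>+x. (\<Sum>k. (L ^^ (k + n)) h x) \<partial>\<beta>)"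
    by (intro nn_integral_cong L_funpow_one_suminf) (simp add: space_\<beta>)
  also have "\<dots> = (\<Sum>k. \<integral>\<^sup>+x. (L ^^ (k + n)) h x \<partial>\<beta>)"
    by (intro nn_integral_suminf) (simp add: measurable_\<beta>_iff)
  also have "\<dots> = (\<Sum>k. ennreal (p (Suc (k + n))))"
    by (simp only: p_Suc)
  finally have eq: "(\<integral>\<^sup>+x. (L ^^ n) (\<lambda>_. 1) x \<partial>\<beta>) = (\<Sum>k. ennreal (p (Suc (k + n))))" .
  have "(\<integral>\<^sup>+x. (L ^^ n) (\<lambda>_. 1) x \<partial>\<beta>) \<le> (\<integral>\<^sup>+x. 1 \<partial>\<beta>)"
    by (intro nn_integral_mono L_funpow_one_le) (simp add: space_\<beta>)
  then have "(\<Sum>k. ennreal (p (Suc (k + n)))) \<noteq> \<top>"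
    unfolding eq using \<beta>.emeasure_space_1 by (auto simp: top_unique)
  then show s: "summable (\<lambda>k. p (Suc (k + n)))"
    by (intro summable_suminf_not_top p_nonneg) auto
  \<comment> \<open>\<open>tail_sum\<close> is an unordered sum over indices greater than
    \<open>n\<close>; it is matched with the series by reindexing.\<close>
  then have "((\<lambda>k. p (Suc (k + n))) has_sum (\<Sum>k. p (Suc (k + n)))) UNIV"
    by (intro norm_summable_imp_has_sum) (auto simp: p_nonneg summable_sums)
  moreover have "bij_betw (\<lambda>k. Suc (k + n)) UNIV {n<..}"
    by (rule bij_betwI[where g="\<lambda>k. k - Suc n"]) auto
  ultimately have "(p has_sum (\<Sum>k. p (Suc (k + n)))) {n<..}"
    using has_sum_reindex_bij_betw by blast
  then show t: "tail_sum p n = (\<Sum>k. p (Suc (k + n)))"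
    unfolding tail_sum_def by (rule infsumI)
  show "ennreal (tail_sum p n) = (\<integral>\<^sup>+x. (L ^^ n) (\<lambda>_. 1) x \<partial>\<beta>)"
    unfolding eq t using s by (intro suminf_ennreal2[symmetric] p_nonneg)
qed

lemma tail_sum_nonneg: "0 \<le> tail_sum p n"
  unfolding tail_sum_eq using summable_p by (intro suminf_nonneg p_nonneg)

lemma tail_sum_0: "tail_sum p 0 = 1"
proof -
  have "ennreal (tail_sum p 0) = ennreal 1"
    using prob_space.emeasure_space_1[OF prob_space_\<beta>] by (simp add: tail_sum_p)
  then show ?thesis
    using tail_sum_nonneg[of 0] by (simp del: ennreal_1)
qed

lemma tail_sum_Suc: "tail_sum p n = tail_sum p (Suc n) + p (Suc n)"
  unfolding tail_sum_eq using suminf_split_head[OF summable_p[of n]] by simp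

context
  fixes q assumes q: "jump_probabilities p q"
begin

lemma q_bounds: "0 \<le> q n \<and> q n \<le> 1"
  using q by (auto simp: jump_probabilities_def)

text \<open>Where the tail sum is 0 the value of \<open>q\<close> is arbitrary, but then
  \<open>p (Suc n)\<close> is 0 as well.\<close>

lemma tail_sum_q: "tail_sum p n * q n = p (Suc n)"
proof (cases "tail_sum p n = 0")
  case True
  then show ?thesis
    using tail_sum_Suc[of n] tail_sum_nonneg[of "Suc n"] p_nonneg[of "Suc n"] by simp
next
  case False
  then show ?thesis
    using q tail_sum_nonneg[of n] by (auto simp: jump_probabilities_def)
qed

lemma pmf_model_state_p:
  "pmf (model_state q m) j = (if j \<le> m then pmf (model_state q (m - j)) 0 * tail_sum p j else 0)"
proof (rule pmf_model_state)
  show "tail_sum p n * (1 - q n) = tail_sum p (Suc n)" for n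
    using tail_sum_q[of n] tail_sum_Suc[of n] by (simp add: algebra_simps)
qed (use q_bounds tail_sum_0 in auto)

text \<open>The renewal equation for the probabilities of being at 0: the preceding visit to 0 took
  place at time \<open>m - j\<close>, and the cycle started there has length \<open>j + 1\<close>,
  with probability \<open>p (Suc j)\<close>.\<close>

lemma model_state_renewal:
  "pmf (model_state q (Suc m)) 0 = (\<Sum>j\<le>m. pmf (model_state q (m - j)) 0 * p (Suc j))"
proof -
  have "pmf (model_state q (Suc m)) 0 = pmf (model_op q (model_state q m)) 0"
    by (simp add: model_state_def)
  also have "\<dots> = (\<Sum>j\<le>m. pmf (model_state q m) j * q j)"
    using q_bounds by (intro pmf_model_op_0) (auto simp: pmf_model_state_p[of m])
  also have "\<dots> = (\<Sum>j\<le>m. pmf (model_state q (m - j)) 0 * p (Suc j))"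
    by (intro sum.cong refl) (simp add: pmf_model_state_p[of m] mult.assoc tail_sum_q)
  finally show ?thesis .
qed

text \<open>Decomposition at the last regeneration, time 0 counting as one: the weight of age
  \<open>j\<close> is the probability that the model chain is at 0 at time \<open>m - j\<close>.
  Splitting off one step by \<open>K = L + h \<otimes> \<beta>\<close> yields the terms with shifted
  \<open>j\<close>, and the rest is collected by the renewal equation.\<close>

lemma nn_integral_kernel_op_\<beta>:
  assumes "f \<in> borel_measurable M"
  shows "(\<integral>\<^sup>+x. (kernel_op ^^ m) f x \<partial>\<beta>) =
    (\<Sum>j\<le>m. ennreal (pmf (model_state q (m - j)) 0) * (\<integral>\<^sup>+x. (L ^^ j) f x \<partial>\<beta>))"
  using assms
proof (induction m arbitrary: f)
  case 0
  then show ?case by (simp add: model_state_def)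
next
  case (Suc m)
  note [measurable] = Suc.prems
  let ?r = "\<lambda>m. ennreal (pmf (model_state q m) 0)" and ?B = "\<lambda>j. \<integral>\<^sup>+x. (L ^^ j) f x \<partial>\<beta>"
  have B: "(\<integral>\<^sup>+x. (L ^^ j) (kernel_op f) x \<partial>\<beta>) = ?B (Suc j) + ennreal (p (Suc j)) * ?B 0" for j
  proof -
    have "(\<integral>\<^sup>+x. (L ^^ j) (kernel_op f) x \<partial>\<beta>) = (\<integral>\<^sup>+x. (L ^^ Suc j) f x + (L ^^ j) h x * ?B 0 \<partial>\<beta>)"
      using L_funpow_kernel_op[OF Suc.prems] by (intro nn_integral_cong) (simp add: space_\<beta>)
    also have "\<dots> = ?B (Suc j) + (\<integral>\<^sup>+x. (L ^^ j) h x \<partial>\<beta>) * ?B 0"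
      by (subst nn_integral_add, simp_all only: measurable_\<beta>_iff)
        (measurable, subst nn_integral_multc, simp_all only: measurable_\<beta>_iff, measurable)
    finally show ?thesis by (simp only: p_Suc)
  qed
  have "(\<integral>\<^sup>+x. (kernel_op ^^ Suc m) f x \<partial>\<beta>) = (\<integral>\<^sup>+x. (kernel_op ^^ m) (kernel_op f) x \<partial>\<beta>)"
    by (simp only: funpow_Suc_right o_apply)
  also have "\<dots> = (\<Sum>j\<le>m. ?r (m - j) * (?B (Suc j) + ennreal (p (Suc j)) * ?B 0))"
    by (subst Suc.IH) (simp_all only: B, measurable)
  also have "\<dots> = (\<Sum>j\<le>m. ?r (m - j) * ennreal (p (Suc j))) * ?B 0 + (\<Sum>j\<le>m. ?r (m - j) * ?B (Suc j))"
    by (simp only: distrib_left sum.distrib sum_distrib_right mult.assoc add.commute)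
  also have "(\<Sum>j\<le>m. ?r (m - j) * ennreal (p (Suc j))) = ?r (Suc m)"
    unfolding model_state_renewal by (simp add: ennreal_mult p_nonneg sum_ennreal[symmetric])
  also have "?r (Suc m) * ?B 0 + (\<Sum>j\<le>m. ?r (m - j) * ?B (Suc j)) = (\<Sum>j\<le>Suc m. ?r (Suc m - j) * ?B j)"
    by (simp only: sum.atMost_Suc_shift diff_zero diff_Suc_Suc)
  finally show ?case .
qed

text \<open>The mean of \<open>f\<close> at any time is an average over the age, distributed as the
  model chain, of conditional means in \<open>[0, 1]\<close> that do not depend on the time. Two
  times therefore differ by at most the distance of the age distributions.\<close>

lemma kernel_op_\<beta>_diff_le_model_decay:
  assumes f[measurable]: "f \<in> borel_measurable M" and f1: "\<And>x. x \<in> space M \<Longrightarrow> f x \<le> 1"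
  shows "\<bar>enn2real (\<integral>\<^sup>+x. (kernel_op ^^ n) f x \<partial>\<beta>) - enn2real (\<integral>\<^sup>+x. (kernel_op ^^ (n + l)) f x \<partial>\<beta>)\<bar>
    \<le> model_decay q l n"
proof -
  define B where "B j = enn2real (\<integral>\<^sup>+x. (L ^^ j) f x \<partial>\<beta>)" for j
  have le: "(\<integral>\<^sup>+x. (L ^^ j) f x \<partial>\<beta>) \<le> ennreal (tail_sum p j)" for j
    unfolding tail_sum_p by (intro nn_integral_mono L_funpow_mono f1) (auto simp: space_\<beta>)
  then have B: "(\<integral>\<^sup>+x. (L ^^ j) f x \<partial>\<beta>) = ennreal (B j)" for j
    unfolding B_def using le_less_trans[OF le ennreal_less_top] by simp
  have B_le: "B j \<le> tail_sum p j" for j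
    unfolding B_def using le by (intro enn2real_leI tail_sum_nonneg)
  have B0: "0 \<le> B j" for j by (simp add: B_def)
  \<comment> \<open>the mean of \<open>f X\<^sub>m\<close> given that the last regeneration occurred \<open>j\<close> steps ago\<close>
  define \<kappa> where "\<kappa> j = (if tail_sum p j = 0 then 0 else B j / tail_sum p j)" for j
  have \<kappa>: "0 \<le> \<kappa> j" "\<kappa> j \<le> 1" "B j = tail_sum p j * \<kappa> j" for j
    using B0[of j] B_le[of j] tail_sum_nonneg[of j] by (auto simp: \<kappa>_def divide_le_eq)
  \<comment> \<open>Ages above \<open>m\<close> have mass 0, so one range of summation serves for
    the times \<open>n\<close> and \<open>n + l\<close> alike.\<close>
  have eq: "enn2real (\<integral>\<^sup>+x. (kernel_op ^^ m) f x \<partial>\<beta>) = (\<Sum>j\<le>N. pmf (model_state q m) j * \<kappa> j)"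
    if "m \<le> N" for m N
  proof -
    have "(\<integral>\<^sup>+x. (kernel_op ^^ m) f x \<partial>\<beta>) = ennreal (\<Sum>j\<le>m. pmf (model_state q (m - j)) 0 * B j)"
      unfolding nn_integral_kernel_op_\<beta>[OF f] by (simp add: B B0 ennreal_mult sum_ennreal[symmetric])
    then have "enn2real (\<integral>\<^sup>+x. (kernel_op ^^ m) f x \<partial>\<beta>) = (\<Sum>j\<le>m. pmf (model_state q (m - j)) 0 * B j)"
      by (simp add: B0 sum_nonneg)
    also have "\<dots> = (\<Sum>j\<le>m. pmf (model_state q m) j * \<kappa> j)"
      by (intro sum.cong refl) (simp add: pmf_model_state_p[of m] \<kappa>(3) mult.assoc)
    also have "\<dots> = (\<Sum>j\<le>N. pmf (model_state q m) j * \<kappa> j)"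
      using that by (intro sum.mono_neutral_left) (auto simp: pmf_model_state_p[of m])
    finally show ?thesis .
  qed
  have "\<bar>enn2real (\<integral>\<^sup>+x. (kernel_op ^^ n) f x \<partial>\<beta>) - enn2real (\<integral>\<^sup>+x. (kernel_op ^^ (n + l)) f x \<partial>\<beta>)\<bar> =
      \<bar>\<Sum>j\<le>n + l. (pmf (model_state q n) j - pmf (model_state q (n + l)) j) * \<kappa> j\<bar>"
    by (simp add: eq[of _ "n + l"] sum_subtractf left_diff_distrib del: sum.atMost_Suc)
  also have "\<dots> \<le> (\<Sum>j\<le>n + l. \<bar>pmf (model_state q n) j - pmf (model_state q (n + l)) j\<bar>)"
    using \<kappa>(1,2) by (intro order_trans[OF sum_abs] sum_mono) (auto simp: abs_mult intro!: mult_left_le)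
  also have "\<dots> \<le> model_decay q l n"
    unfolding model_decay_eq by (rule sum_abs_pmf_diff_le_tv_dist) simp
  finally show ?thesis .
qed

end

section \<open>Two arbitrary initial distributions\<close>

lemma variation_tau_0: "variation_tau M K S \<epsilon> \<beta> \<mu> \<mu>' 0 = 0"
  by (simp add: variation_tau_def tau_prob_0)

text \<open>The scaling to a probability measure cancels against the total mass. If the mass is 0,
  both sides vanish, whichever law is chosen.\<close>

lemma variation_tau_Suc:
  assumes \<mu>: "\<mu> \<in> space (prob_algebra M)" and \<mu>': "\<mu>' \<in> space (prob_algebra M)"
  shows "variation_tau M K S \<epsilon> \<beta> \<mu> \<mu>' (Suc k) = (\<integral>\<^sup>+x. (L ^^ k) h x \<partial>variation_measure \<mu> \<mu>')"
proof -
  let ?V = "variation_measure \<mu> \<mu>'"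
  have P: "prob_space \<mu>" "prob_space \<mu>'" "sets \<mu>' = sets \<mu>" and s\<mu>: "sets \<mu> = sets M"
    using \<mu> \<mu>' by (auto simp: space_prob_algebra)
  interpret V: finite_measure ?V using P by (rule variation_measure_finite)
  have sV: "sets ?V = sets M"
    using sets_variation_measure[OF P] s\<mu> by simp
  have spV: "space ?V = space M"
    using sV by (rule sets_eq_imp_space_eq)
  have meas: "(L ^^ k) h \<in> borel_measurable ?V"
    by (simp add: measurable_cong_sets[OF sV refl])
  define m where "m = emeasure ?V (space M)"
  have eq: "variation_tau M K S \<epsilon> \<beta> \<mu> \<mu>' (Suc k) =
      m * ennreal (tau_prob M K S \<epsilon> \<beta> (if m = 0 then \<mu> else scale_measure (1 / m) ?V) (Suc k))"
    by (simp add: variation_tau_def normalized_variation_def Let_def m_def spV)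
  show ?thesis
  proof (cases "m = 0")
    case True
    then have "AE x in ?V. (L ^^ k) h x = 0"
      by (intro AE_I[of _ _ "space M"]) (auto simp: m_def spV sV)
    then have "(\<integral>\<^sup>+x. (L ^^ k) h x \<partial>?V) = 0"
      using meas by (simp add: nn_integral_0_iff_AE)
    with True eq show ?thesis by simp
  next
    case False
    have "m \<noteq> \<top>"
      using V.emeasure_finite by (simp add: m_def)
    with False have m: "m * (1 / m) = 1" "1 / m * m = 1"
      by (simp_all add: ennreal_times_divide ennreal_divide_times less_top[symmetric])
    have "scale_measure (1 / m) ?V \<in> space (prob_algebra M)"
      using m by (auto simp: space_prob_algebra sV spV space_scale_measure m_def[symmetric] intro!: prob_spaceI)
    then have "ennreal (tau_prob M K S \<epsilon> \<beta> (scale_measure (1 / m) ?V) (Suc k)) = (1 / m) * (\<integral>\<^sup>+x. (L ^^ k) h x \<partial>?V)"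
      using meas by (simp add: tau_prob_Suc nn_integral_scale_measure)
    with False eq m show ?thesis
      by (simp add: mult.assoc[symmetric])
  qed
qed

lemma g_norm_eq:
  assumes \<mu>: "\<mu> \<in> space (prob_algebra M)" and \<mu>': "\<mu>' \<in> space (prob_algebra M)"
  shows "g_norm M K S \<epsilon> \<beta> g \<mu> \<mu>' =
    (\<Sum>k. ennreal (g (Suc k)) * (\<integral>\<^sup>+x. (L ^^ k) h x \<partial>variation_measure \<mu> \<mu>'))"
proof -
  have "g_norm M K S \<epsilon> \<beta> g \<mu> \<mu>' = (\<Sum>l. ennreal (g (l + 1)) * variation_tau M K S \<epsilon> \<beta> \<mu> \<mu>' (l + 1))"
    unfolding g_norm_def by (subst suminf_offset[of _ 1]) (auto simp: variation_tau_0)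
  then show ?thesis
    by (simp add: variation_tau_Suc[OF \<mu> \<mu>'])
qed

context
  fixes q assumes q: "jump_probabilities p q"
begin

text \<open>Both means are expanded at the first regeneration up to time \<open>m\<close>. The part
  without regeneration costs one survival term. In the regenerated part every restart mean is
  replaced by \<open>c 0\<close>; the replacement costs the decay terms, and the coefficient of
  \<open>c 0\<close> is again a survival term.\<close>

lemma kernel_op_diff_le:
  assumes \<mu>: "\<mu> \<in> space (prob_algebra M)" and \<mu>': "\<mu>' \<in> space (prob_algebra M)"
    and f[measurable]: "f \<in> borel_measurable M" and f1: "\<And>x. x \<in> space M \<Longrightarrow> f x \<le> 1"
    and m: "2 * m \<le> n"
  defines "V \<equiv> variation_measure \<mu> \<mu>'"
  shows "\<bar>enn2real (\<integral>\<^sup>+x. (kernel_op ^^ n) f x \<partial>\<mu>) - enn2real (\<integral>\<^sup>+x. (kernel_op ^^ n) f x \<partial>\<mu>')\<bar> \<le>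
    2 * enn2real (\<integral>\<^sup>+x. (L ^^ m) (\<lambda>_. 1) x \<partial>V) +
    (\<Sum>k<m. enn2real (\<integral>\<^sup>+x. (L ^^ k) h x \<partial>V) * model_decay q (Suc k) m)"
proof -
  define I where "I N F = enn2real (\<integral>\<^sup>+x. F x \<partial>N)" for N :: "'a measure" and F
  let ?w = "(L ^^ m) (\<lambda>_. 1)" and ?u = "\<lambda>k. (L ^^ k) h"
  define f' where "f' = (kernel_op ^^ (n - m)) f"
  have f'[measurable]: "f' \<in> borel_measurable M"
    by (simp add: f'_def)
  have f'1: "f' x \<le> 1" if "x \<in> space M" for x
    unfolding f'_def using f1 that by (rule kernel_op_funpow_le_1)
  have P: "prob_space \<mu>" "prob_space \<mu>'" "sets \<mu>' = sets \<mu>" and s\<mu>: "sets \<mu> = sets M"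
    using \<mu> \<mu>' by (auto simp: space_prob_algebra)
  have diff: "\<bar>I \<mu> F - I \<mu>' F\<bar> \<le> I V F" if "F \<in> borel_measurable M" "\<And>x. x \<in> space M \<Longrightarrow> F x \<le> 1" for F
    unfolding I_def V_def using that P s\<mu> sets_eq_imp_space_eq[OF s\<mu>]
    by (intro nn_integral_diff_le_variation) (simp_all add: measurable_cong_sets[OF s\<mu> refl])
  have u1: "?u k x \<le> 1" if "x \<in> space M" for k x
  proof -
    have "?u k x \<le> (L ^^ k) (\<lambda>_. 1) x"
      unfolding L_funpow_one_split[OF that, of k] by (rule add_increasing) simp_all
    then show ?thesis
      using L_funpow_one_le[OF that] by (rule order_trans)
  qed
  \<comment> \<open>The mean of \<open>f\<close> after a restart from \<open>\<beta>\<close> at time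
    \<open>k\<close>, evaluated at time \<open>n\<close>.\<close>
  define c where "c k = I \<beta> ((kernel_op ^^ (n - k)) f)" for k
  have bnd: "(\<integral>\<^sup>+x. F x \<partial>N) \<le> 1"
    if N: "prob_space N" "sets N = sets M" and F: "\<And>x. x \<in> space M \<Longrightarrow> F x \<le> 1" for N F
  proof -
    interpret N: prob_space N by fact
    have "(\<integral>\<^sup>+x. F x \<partial>N) \<le> (\<integral>\<^sup>+x. 1 \<partial>N)"
      using F sets_eq_imp_space_eq[OF N(2)] by (intro nn_integral_mono) auto
    then show ?thesis by (simp add: N.emeasure_space_1)
  qed
  have fin: "(\<integral>\<^sup>+x. F x \<partial>N) < \<top>"
    if "prob_space N" "sets N = sets M" "\<And>x. x \<in> space M \<Longrightarrow> F x \<le> 1" for N F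
    using le_less_trans[OF bnd[OF that] ennreal_one_less_top] by simp
  have Kf1: "(kernel_op ^^ k) f x \<le> 1" if "x \<in> space M" for k x
    using f1 that by (rule kernel_op_funpow_le_1)
  have c_enn: "ennreal (c k) = (\<integral>\<^sup>+x. (kernel_op ^^ (n - k)) f x \<partial>\<beta>)" for k
    unfolding c_def I_def using fin[OF prob_space_\<beta> sets_\<beta> Kf1[where k="n - k"]] by simp
  have c01: "0 \<le> c k" "c k \<le> 1" for k
    using bnd[OF prob_space_\<beta> sets_\<beta> Kf1[where k="n - k"]] unfolding c_def I_def
    by (auto intro: enn2real_leI)
  have c_diff: "\<bar>c (Suc k) - c 0\<bar> \<le> model_decay q (Suc k) m" if k: "k < m" for k
  proof -
    \<comment> \<open>The surplus of \<open>d\<close> steps goes into the test function, so that the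
      decay is taken exactly at time \<open>m\<close>. It fits because \<open>Suc k \<le> m\<close>
      and \<open>2 * m \<le> n\<close>.\<close>
    define d where "d = n - Suc k - m"
    have "n - Suc k = m + d" and n: "n = m + Suc k + d"
      using k m by (auto simp: d_def)
    then have "c (Suc k) = I \<beta> ((kernel_op ^^ m) ((kernel_op ^^ d) f))"
      unfolding c_def by (simp only: funpow_add o_apply)
    moreover have "c 0 = I \<beta> ((kernel_op ^^ (m + Suc k)) ((kernel_op ^^ d) f))"
      unfolding c_def diff_zero by (simp only: n funpow_add o_apply)
    ultimately show ?thesis
      unfolding I_def using kernel_op_\<beta>_diff_le_model_decay[OF q, of "(kernel_op ^^ d) f" m "Suc k"] Kf1 by simp
  qed
  have decomp: "I N ((kernel_op ^^ n) f) = I N ((L ^^ m) f') + (\<Sum>k<m. I N (?u k) * c (Suc k))"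
    and one: "1 = I N ?w + (\<Sum>k<m. I N (?u k))"
    if N: "prob_space N" "sets N = sets M" for N
  proof -
    note cong = measurable_cong_sets[OF N(2) refl]
    have uN: "(\<integral>\<^sup>+x. ?u k x \<partial>N) = ennreal (I N (?u k))" for k
      unfolding I_def using fin[OF N u1[where k=k]] by simp
    have wN: "(\<integral>\<^sup>+x. ?w x \<partial>N) = ennreal (I N ?w)"
      unfolding I_def using fin[OF N L_funpow_one_le[where n=m]] by simp
    have f'N: "(\<integral>\<^sup>+x. (L ^^ m) f' x \<partial>N) = ennreal (I N ((L ^^ m) f'))"
      unfolding I_def using fin[OF N order_trans[OF L_funpow_mono[OF f'1] L_funpow_one_le[where n=m]]] by simp
    have I0: "0 \<le> I N F" for F by (simp add: I_def)
    have "(kernel_op ^^ n) f x = (L ^^ m) f' x + (\<Sum>k<m. ?u k x * ennreal (c (Suc k)))" if x: "x \<in> space M" for x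
    proof -
      have "(kernel_op ^^ (m + (n - m))) f x = (L ^^ m) f' x +
          (\<Sum>k<m. ?u k x * (\<integral>\<^sup>+y. (kernel_op ^^ (m - Suc k + (n - m))) f y \<partial>\<beta>))"
        unfolding f'_def using f x by (rule kernel_op_funpow_decomp)
      also have "(\<Sum>k<m. ?u k x * (\<integral>\<^sup>+y. (kernel_op ^^ (m - Suc k + (n - m))) f y \<partial>\<beta>)) =
          (\<Sum>k<m. ?u k x * ennreal (c (Suc k)))"
        using m by (intro sum.cong refl) (simp add: c_enn)
      finally show ?thesis using m by simp
    qed
    then have "(\<integral>\<^sup>+x. (kernel_op ^^ n) f x \<partial>N) = (\<integral>\<^sup>+x. (L ^^ m) f' x + (\<Sum>k<m. ?u k x * ennreal (c (Suc k))) \<partial>N)"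
      using sets_eq_imp_space_eq[OF N(2)] by (intro nn_integral_cong) auto
    also have "\<dots> = (\<integral>\<^sup>+x. (L ^^ m) f' x \<partial>N) + (\<Sum>k<m. (\<integral>\<^sup>+x. ?u k x \<partial>N) * ennreal (c (Suc k)))"
      by (simp add: nn_integral_add nn_integral_sum nn_integral_multc cong)
    also have "\<dots> = ennreal (I N ((L ^^ m) f') + (\<Sum>k<m. I N (?u k) * c (Suc k)))"
      unfolding uN f'N by (simp add: I0 c01 sum_nonneg ennreal_mult sum_ennreal[symmetric])
    finally show "I N ((kernel_op ^^ n) f) = I N ((L ^^ m) f') + (\<Sum>k<m. I N (?u k) * c (Suc k))"
      by (simp add: I_def[of N "(kernel_op ^^ n) f"] I0 c01 sum_nonneg del: ennreal_plus)
    have "1 = (\<integral>\<^sup>+x. 1 \<partial>N)"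
      using prob_space.emeasure_space_1[OF N(1)] by simp
    also have "\<dots> = (\<integral>\<^sup>+x. ?w x + (\<Sum>k<m. ?u k x) \<partial>N)"
      using L_funpow_one_sum[of _ 0 m] sets_eq_imp_space_eq[OF N(2)] by (intro nn_integral_cong) simp
    also have "\<dots> = (\<integral>\<^sup>+x. ?w x \<partial>N) + (\<Sum>k<m. \<integral>\<^sup>+x. ?u k x \<partial>N)"
      by (simp add: nn_integral_add nn_integral_sum cong)
    also have "\<dots> = ennreal (I N ?w + (\<Sum>k<m. I N (?u k)))"
      unfolding uN wN by (simp add: I0 sum_nonneg)
    finally have "ennreal 1 = ennreal (I N ?w + (\<Sum>k<m. I N (?u k)))"
      by simp
    then show "1 = I N ?w + (\<Sum>k<m. I N (?u k))"
      by (subst (asm) ennreal_inj) (simp_all add: I0 sum_nonneg)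
  qed
  let ?d = "\<lambda>F. I \<mu> F - I \<mu>' F"
  have s\<mu>': "sets \<mu>' = sets M" using P s\<mu> by simp
  \<comment> \<open>Both measures have total mass 1, so their difference on
    \<open>\<tau> \<le> m\<close> is the opposite of that on \<open>\<tau> > m\<close>.\<close>
  have d_one: "(\<Sum>k<m. ?d (?u k)) = - ?d ?w"
    using one[OF P(1) s\<mu>] one[OF P(2) s\<mu>'] by (simp add: sum_subtractf)
  have "?d ((kernel_op ^^ n) f) = ?d ((L ^^ m) f') + (\<Sum>k<m. ?d (?u k) * c (Suc k))"
    unfolding decomp[OF P(1) s\<mu>] decomp[OF P(2) s\<mu>'] by (simp add: sum_subtractf left_diff_distrib)
  also have "(\<Sum>k<m. ?d (?u k) * c (Suc k)) = (\<Sum>k<m. ?d (?u k) * (c (Suc k) - c 0)) + (\<Sum>k<m. ?d (?u k)) * c 0"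
    unfolding sum_distrib_right sum.distrib[symmetric]
    by (intro sum.cong refl) (simp add: algebra_simps)
  finally have eq: "?d ((kernel_op ^^ n) f) =
      ?d ((L ^^ m) f') + (\<Sum>k<m. ?d (?u k) * (c (Suc k) - c 0)) - ?d ?w * c 0"
    unfolding d_one by (simp add: left_diff_distrib)
  interpret V: finite_measure V
    unfolding V_def using P by (rule variation_measure_finite)
  have sV: "sets V = sets M"
    unfolding V_def using sets_variation_measure[OF P] s\<mu> by simp
  have f'_le: "(L ^^ m) f' x \<le> ?w x" if "x \<in> space M" for x
    using f'1 that by (rule L_funpow_mono)
  have "I V ((L ^^ m) f') \<le> I V ?w"
    unfolding I_def
  proof (rule enn2real_mono)
    show "(\<integral>\<^sup>+x. (L ^^ m) f' x \<partial>V) \<le> (\<integral>\<^sup>+x. ?w x \<partial>V)"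
      using f'_le sets_eq_imp_space_eq[OF sV] by (intro nn_integral_mono) auto
    have "(\<integral>\<^sup>+x. ?w x \<partial>V) \<le> (\<integral>\<^sup>+x. 1 \<partial>V)"
      using L_funpow_one_le sets_eq_imp_space_eq[OF sV] by (intro nn_integral_mono) auto
    also have "\<dots> < \<top>"
      using V.emeasure_finite[of "space V"] by (simp add: less_top[symmetric])
    finally show "(\<integral>\<^sup>+x. ?w x \<partial>V) < \<top>" .
  qed
  moreover have "\<bar>?d ((L ^^ m) f')\<bar> \<le> I V ((L ^^ m) f')"
    using order_trans[OF f'_le L_funpow_one_le] by (intro diff) simp_all
  moreover have "\<bar>?d ?w * c 0\<bar> \<le> I V ?w"
  proof -
    have "\<bar>?d ?w * c 0\<bar> \<le> \<bar>?d ?w\<bar>"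
      using c01[of 0] by (simp add: abs_mult mult_left_le)
    also have "\<dots> \<le> I V ?w"
      using L_funpow_one_le by (intro diff) simp_all
    finally show ?thesis .
  qed
  moreover have "\<bar>\<Sum>k<m. ?d (?u k) * (c (Suc k) - c 0)\<bar> \<le> (\<Sum>k<m. I V (?u k) * model_decay q (Suc k) m)"
  proof (rule order_trans[OF sum_abs], rule sum_mono)
    fix k assume "k \<in> {..<m}"
    then have "\<bar>c (Suc k) - c 0\<bar> \<le> model_decay q (Suc k) m"
      by (intro c_diff) simp
    moreover have "\<bar>?d (?u k)\<bar> \<le> I V (?u k)"
      using u1 by (intro diff) simp_all
    ultimately show "\<bar>?d (?u k) * (c (Suc k) - c 0)\<bar> \<le> I V (?u k) * model_decay q (Suc k) m"
      unfolding abs_mult by (intro mult_mono) (auto simp: I_def)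
  qed
  ultimately have "\<bar>?d ((kernel_op ^^ n) f)\<bar> \<le> 2 * I V ?w + (\<Sum>k<m. I V (?u k) * model_decay q (Suc k) m)"
    unfolding eq by linarith
  then show ?thesis
    by (simp add: I_def)
qed

text \<open>The preceding estimate for indicator functions; the factor 2 in \<open>tv_dist\<close>
  doubles both coefficients.\<close>

lemma tv_dist_transition_op_le:
  assumes \<mu>: "\<mu> \<in> space (prob_algebra M)" and \<mu>': "\<mu>' \<in> space (prob_algebra M)"
    and m: "2 * m \<le> n"
  defines "V \<equiv> variation_measure \<mu> \<mu>'"
  shows "tv_dist ((transition_op K ^^ n) \<mu>) ((transition_op K ^^ n) \<mu>') \<le>
    4 * enn2real (\<integral>\<^sup>+x. (L ^^ m) (\<lambda>_. 1) x \<partial>V) +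
    2 * (\<Sum>k<m. enn2real (\<integral>\<^sup>+x. (L ^^ k) h x \<partial>V) * model_decay q (Suc k) m)"
proof -
  have meas: "measure ((transition_op K ^^ n) \<nu>) A = enn2real (\<integral>\<^sup>+x. (kernel_op ^^ n) (indicator A) x \<partial>\<nu>)"
    and sets: "sets ((transition_op K ^^ n) \<nu>) = sets M"
    if "\<nu> \<in> space (prob_algebra M)" "A \<in> sets M" for \<nu> A
  proof -
    show s: "sets ((transition_op K ^^ n) \<nu>) = sets M"
      using transition_op_funpow(1)[OF that(1), of n] by (simp add: space_prob_algebra)
    show "measure ((transition_op K ^^ n) \<nu>) A = enn2real (\<integral>\<^sup>+x. (kernel_op ^^ n) (indicator A) x \<partial>\<nu>)"
      using transition_op_funpow(2)[OF that(1), of "indicator A" n] that(2) s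
      by (simp add: measure_def)
  qed
  have "(SUP A\<in>sets ((transition_op K ^^ n) \<mu>).
      \<bar>measure ((transition_op K ^^ n) \<mu>) A - measure ((transition_op K ^^ n) \<mu>') A\<bar>) \<le>
    2 * enn2real (\<integral>\<^sup>+x. (L ^^ m) (\<lambda>_. 1) x \<partial>V) +
    (\<Sum>k<m. enn2real (\<integral>\<^sup>+x. (L ^^ k) h x \<partial>V) * model_decay q (Suc k) m)"
  proof (rule cSUP_least)
    fix A assume "A \<in> sets ((transition_op K ^^ n) \<mu>)"
    then have A: "A \<in> sets M"
      using sets[OF \<mu> sets.empty_sets] by simp
    show "\<bar>measure ((transition_op K ^^ n) \<mu>) A - measure ((transition_op K ^^ n) \<mu>') A\<bar> \<le>
        2 * enn2real (\<integral>\<^sup>+x. (L ^^ m) (\<lambda>_. 1) x \<partial>V) +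
        (\<Sum>k<m. enn2real (\<integral>\<^sup>+x. (L ^^ k) h x \<partial>V) * model_decay q (Suc k) m)"
      unfolding meas[OF \<mu> A] meas[OF \<mu>' A] V_def
      using A m by (intro kernel_op_diff_le \<mu> \<mu>') (auto split: split_indicator)
  qed auto
  then show ?thesis
    by (simp add: tv_dist_def)
qed

end

end

section \<open>The rate: Markov's inequality and regular variation\<close>

theorem proposition3p8:
  fixes M :: "'a measure" and K :: "'a \<Rightarrow> 'a measure"
    and S :: "'a set" and \<epsilon> :: real and \<beta> :: "'a measure"
    and q \<rho> g :: "nat \<Rightarrow> real"
  assumes harris: "harris_chain M K S \<epsilon> \<beta>"
    and model: "jump_probabilities (tau_prob M K S \<epsilon> \<beta> \<beta>) q"
    and rho: "regularly_varying_seq 1 \<rho>"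
    and g: "regularly_varying_seq 1 g"
    and g_incr: "mono_on {1..} g"
    and decay: "\<exists>C>0. \<forall>n l. 1 \<le> l \<and> l \<le> n \<longrightarrow> model_decay q l n \<le> C * (\<rho> n * g l)"
  shows "\<exists>C>0. \<forall>n\<ge>1. \<forall>\<mu>\<in>space (prob_algebra M). \<forall>\<mu>'\<in>space (prob_algebra M).
    ennreal (tv_dist ((transition_op K ^^ n) \<mu>) ((transition_op K ^^ n) \<mu>'))
      \<le> ennreal (C * (\<rho> n + 1 / g n)) * g_norm M K S \<epsilon> \<beta> g \<mu> \<mu>'"
proof -
  interpret harris_chain M K S \<epsilon> \<beta> by (rule harris)
  have q: "jump_probabilities p q"
    using model by (simp add: p_def)
  note rho_pos = regularly_varying_seq_pos[OF rho] and g_pos = regularly_varying_seq_pos[OF g]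
  obtain C where C: "0 < C" "\<And>n l. 1 \<le> l \<Longrightarrow> l \<le> n \<Longrightarrow> model_decay q l n \<le> C * (\<rho> n * g l)"
    using decay by blast
  obtain C\<rho> where C\<rho>: "0 < C\<rho>" "\<And>n. 2 \<le> n \<Longrightarrow> \<rho> (n div 2) \<le> C\<rho> * \<rho> n"
    using regularly_varying_seq_half[OF rho] by metis
  obtain c where c: "0 < c" "\<And>n. 2 \<le> n \<Longrightarrow> c * g n \<le> g (n div 2)"
    using regularly_varying_seq_half[OF g] by metis
  \<comment> \<open>The first summand pays for the survival term and the passage from
    \<open>g m\<close> to \<open>g n\<close>, the second for the decay terms and the passage from
    \<open>\<rho> m\<close> to \<open>\<rho> n\<close>.\<close>
  define D where "D = 4 * (1 + 1 / c) + 2 * C * C\<rho>"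
  have D_pos: "0 < D"
    unfolding D_def using C C\<rho> c by (intro add_pos_pos mult_pos_pos) auto
  have "ennreal (tv_dist ((transition_op K ^^ n) \<mu>) ((transition_op K ^^ n) \<mu>'))
      \<le> ennreal (D * (\<rho> n + 1 / g n)) * g_norm M K S \<epsilon> \<beta> g \<mu> \<mu>'"
    if n: "1 \<le> n" and \<mu>: "\<mu> \<in> space (prob_algebra M)" and \<mu>': "\<mu>' \<in> space (prob_algebra M)" for n \<mu> \<mu>'
  proof -
    let ?V = "variation_measure \<mu> \<mu>'" and ?G = "g_norm M K S \<epsilon> \<beta> g \<mu> \<mu>'"
    let ?u = "\<lambda>k. \<integral>\<^sup>+x. (L ^^ k) h x \<partial>?V" and ?w = "\<lambda>m. \<integral>\<^sup>+x. (L ^^ m) (\<lambda>_. 1) x \<partial>?V"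
    have sV: "sets ?V = sets M"
      using sets_variation_measure[of \<mu> \<mu>'] \<mu> \<mu>' by (simp add: space_prob_algebra)
    have coef_pos: "0 < D * (\<rho> n + 1 / g n)"
      using D_pos rho_pos[OF n] g_pos[OF n] by (intro mult_pos_pos add_pos_pos) auto
    show ?thesis
    proof (cases ?G)
      case top
      have "ennreal (D * (\<rho> n + 1 / g n)) * ?G = \<top>"
        using coef_pos by (simp only: top) (auto simp: ennreal_mult_eq_top_iff)
      then show ?thesis by simp
    next
      case (real G)
      define m where "m = n div 2"
      have G: "(\<Sum>k. ennreal (g (Suc k)) * ?u k) = ennreal G"
        using g_norm_eq[OF \<mu> \<mu>'] real by simp
      have w: "?w m = (\<Sum>k. ?u (k + m))"
      proof -
        have "?w m = (\<integral>\<^sup>+x. (\<Sum>k. (L ^^ (k + m)) h x) \<partial>?V)"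
          using sets_eq_imp_space_eq[OF sV] by (intro nn_integral_cong L_funpow_one_suminf) simp
        also have "\<dots> = (\<Sum>k. ?u (k + m))"
          by (intro nn_integral_suminf) (simp add: measurable_cong_sets[OF sV refl])
        finally show ?thesis .
      qed
      \<comment> \<open>For \<open>n = 1\<close> one has \<open>m = 0\<close>, where
        \<open>g\<close> need not be positive; hence the maximum with 1.\<close>
      have gm: "0 < g (max 1 m)"
        by (intro g_pos) simp
      \<comment> \<open>Markov's inequality: on \<open>\<tau> > m\<close> one has
        \<open>\<tau> \<ge> max 1 m\<close>, so monotonicity bounds \<open>g (max 1 m)\<close> by
        \<open>g \<tau>\<close>.\<close>
      have "ennreal (g (max 1 m)) * ?w m = (\<Sum>k. ennreal (g (max 1 m)) * ?u (k + m))"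
        unfolding w by (rule ennreal_suminf_cmult[symmetric])
      also have "\<dots> \<le> (\<Sum>k. ennreal (g (Suc (k + m))) * ?u (k + m))"
        by (intro suminf_le mult_right_mono ennreal_leI mono_onD[OF g_incr]) auto
      also have "\<dots> \<le> (\<Sum>k. ennreal (g (Suc k)) * ?u k)"
        by (subst suminf_offset[of "\<lambda>k. ennreal (g (Suc k)) * ?u k" m]) auto
      finally have gw: "ennreal (g (max 1 m)) * ?w m \<le> ennreal G"
        unfolding G .
      then have "?w m < \<top>"
        using gm by (cases "?w m") (auto simp: ennreal_mult_top top_unique)
      then have "?w m = ennreal (enn2real (?w m))"
        by simp
      with gw have "ennreal (g (max 1 m) * enn2real (?w m)) \<le> ennreal G"
        using gm by (metis ennreal_mult enn2real_nonneg less_imp_le)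
      then have "g (max 1 m) * enn2real (?w m) \<le> G"
        using real by simp
      then have W: "enn2real (?w m) \<le> G / g (max 1 m)"
        using gm by (simp add: field_simps)
      \<comment> \<open>In the constant, 1 covers \<open>n = 1\<close> and \<open>1 / c\<close>
        covers \<open>n \<ge> 2\<close>.\<close>
      have gn: "1 / g (max 1 m) \<le> (1 + 1 / c) * (1 / g n)"
      proof (cases "n = 1")
        case True
        then show ?thesis
          using c(1) g_pos[of 1] by (simp add: m_def field_simps)
      next
        case False
        with n have "2 \<le> n" by simp
        then have "c * g n \<le> g m" "max 1 m = m"
          using c(2) by (auto simp: m_def)
        moreover from this have "1 / g m \<le> 1 / (c * g n)"
          using c(1) g_pos[OF n] by (intro divide_left_mono) (auto intro!: mult_pos_pos order_less_le_trans[of 0 "c * g n" "g m"])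
        moreover have "1 / (c * g n) \<le> (1 + 1 / c) * (1 / g n)"
          using c(1) g_pos[OF n] by (simp add: field_simps)
        ultimately show ?thesis by simp
      qed
      have u_sum: "(\<Sum>k<m. g (Suc k) * enn2real (?u k)) \<le> G"
      proof -
        have le: "(\<Sum>k<m. ennreal (g (Suc k)) * ?u k) \<le> ennreal G"
          unfolding G[symmetric] by (intro sum_le_suminf) auto
        \<comment> \<open>Finiteness of the norm and positivity of \<open>g\<close> make each
          integral finite, so the sum can be moved to the reals.\<close>
        have "?u k = ennreal (enn2real (?u k))" if "k < m" for k
        proof -
          have "ennreal (g (Suc k)) * ?u k \<le> (\<Sum>k<m. ennreal (g (Suc k)) * ?u k)"
            using that by (intro member_le_sum) auto
          with le have "ennreal (g (Suc k)) * ?u k < \<top>"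
            by (meson ennreal_less_top le_less_trans order_trans)
          then have "?u k < \<top>"
            using g_pos[of "Suc k"] by (cases "?u k") (auto simp: ennreal_mult_top)
          then show ?thesis by simp
        qed
        then have "(\<Sum>k<m. ennreal (g (Suc k)) * ?u k) = (\<Sum>k<m. ennreal (g (Suc k) * enn2real (?u k)))"
          using g_pos by (intro sum.cong refl) (metis One_nat_def Suc_leI enn2real_nonneg ennreal_mult less_imp_le lessThan_iff zero_less_Suc)
        also have "\<dots> = ennreal (\<Sum>k<m. g (Suc k) * enn2real (?u k))"
          using less_imp_le[OF g_pos] by (intro sum_ennreal) simp
        finally have "ennreal (\<Sum>k<m. g (Suc k) * enn2real (?u k)) \<le> ennreal G"
          using le by simp
        then show ?thesis using real by simp
      qed
      \<comment> \<open>The decay hypothesis is used at time \<open>m\<close> with lag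
        \<open>Suc k \<le> m\<close>. Its factor \<open>g (Suc k)\<close> rebuilds the norm. For
        \<open>m = 0\<close> the sum is empty.\<close>
      have sum_le: "(\<Sum>k<m. enn2real (?u k) * model_decay q (Suc k) m) \<le> C * C\<rho> * \<rho> n * G"
      proof (cases "m = 0")
        case True
        then show ?thesis
          using C C\<rho> rho_pos[OF n] real by simp
      next
        case False
        have "(\<Sum>k<m. enn2real (?u k) * model_decay q (Suc k) m) \<le> (\<Sum>k<m. enn2real (?u k) * (C * (\<rho> m * g (Suc k))))"
          using C(2) by (intro sum_mono mult_left_mono) auto
        also have "\<dots> = C * \<rho> m * (\<Sum>k<m. g (Suc k) * enn2real (?u k))"
          by (simp add: sum_distrib_left mult_ac)
        also have "\<dots> \<le> C * \<rho> m * G"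
          using False C rho_pos[of m] u_sum by (intro mult_left_mono) auto
        also have "\<dots> \<le> C * (C\<rho> * \<rho> n) * G"
          using False C C\<rho>(2)[of n] real by (intro mult_right_mono mult_left_mono) (auto simp: m_def)
        finally show ?thesis by (simp add: mult_ac)
      qed
      have "tv_dist ((transition_op K ^^ n) \<mu>) ((transition_op K ^^ n) \<mu>') \<le>
          4 * enn2real (?w m) + 2 * (\<Sum>k<m. enn2real (?u k) * model_decay q (Suc k) m)"
        by (rule tv_dist_transition_op_le[OF q \<mu> \<mu>']) (simp add: m_def)
      also have "\<dots> \<le> 4 * ((1 + 1 / c) * (1 / g n) * G) + 2 * (C * C\<rho> * \<rho> n * G)"
      proof -
        have "G / g (max 1 m) \<le> (1 + 1 / c) * (1 / g n) * G"
          using mult_right_mono[OF gn] real by simp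
        with W sum_le show ?thesis by simp
      qed
      also have "\<dots> \<le> D * (\<rho> n + 1 / g n) * G"
      proof -
        \<comment> \<open>Expanding the product leaves two nonnegative cross terms beyond the bound
          already obtained.\<close>
        have "D * (\<rho> n + 1 / g n) * G - (4 * ((1 + 1 / c) * (1 / g n) * G) + 2 * (C * C\<rho> * \<rho> n * G)) =
            4 * (1 + 1 / c) * \<rho> n * G + 2 * C * C\<rho> * (1 / g n) * G"
          by (simp add: D_def algebra_simps add_divide_distrib)
        moreover have "0 \<le> \<dots>"
          using C C\<rho> c(1) rho_pos[OF n] g_pos[OF n] real by (intro add_nonneg_nonneg mult_nonneg_nonneg) auto
        ultimately show ?thesis by simp
      qed
      finally have "ennreal (tv_dist ((transition_op K ^^ n) \<mu>) ((transition_op K ^^ n) \<mu>')) \<le>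
          ennreal (D * (\<rho> n + 1 / g n) * G)"
        by (rule ennreal_leI)
      also have "\<dots> = ennreal (D * (\<rho> n + 1 / g n)) * ?G"
        using coef_pos real by (simp add: ennreal_mult)
      finally show ?thesis .
    qed
  qed
  with D_pos show ?thesis by blast
qed

end
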